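(* Fix an integer $\nu\ge 1$. Let $P$ and $N\le P^2$ be sufficiently large positive integers, and suppose that for every prime $p$ with $P<p\le 2P$ we are given an integer $N_p$ with $N<N_p\le 2N$. Then $$ \sum_{\substack{P<p\le 2P\\ p\ \text{prime}}}\ \max_{\gcd(a,p)=1} |S_p(a;N_p)|^{2\nu} \le \left(P^3+N^\nu+\min\{N^\nu P^{1/2},\,N^{\nu/2}P^2\}\right)N^\nu P^{o(1)} $$ as $P\to\infty$, for any such sequence $(N_p)$. Here $o(1)$ denotes a quantity that tends to $0$ as $P\to\infty$ for fixed $\nu$, uniformly over $N\le P^2$ and over the choice of the $N_p$.
   Context: For a prime $p$ and an integer $u$ with $\gcd(u,p)=1$, the Fermat quotient $q_p(u)$ is the unique integer with $q_p(u)\equiv \frac{u^{p-1}-1}{p}\pmod p$ and $0\le q_p(u)\le p-1$. For an integer $a$ and a positive integer $M$, $$S_p(a;M)=\sum_{\substack{1\le n\le M\\ \gcd(n,p)=1}}\exp\left(2\pi i\, a\, q_p(n)/p\right).$$ The maximum is over integers $a$ with $\gcd(a,p)=1$ (equivalently, over nonzero residue classes modulo $p$). *)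

theory Defs
  imports "HOL-Analysis.Analysis" "HOL-Number_Theory.Number_Theory"
begin

definition fermat_quotient :: "nat \<Rightarrow> int \<Rightarrow> int" where
  "fermat_quotient p u = ((u ^ (p - 1) - 1) div int p) mod int p"

text \<open>For \<open>p\<close> prime and \<open>u\<close> coprime to \<open>p\<close> the \<open>div\<close> above is exact, and the definition is
  the least nonnegative residue.\<close>

lemma fermat_quotient_exact:
  fixes p :: nat and u :: int
  assumes "prime p" "coprime u (int p)"
  shows "int p dvd u ^ (p - 1) - 1"
proof -
  have "[u ^ totient p = 1] (mod int p)"
  proof -
    have n0: "int p > 0" using assms(1) prime_gt_0_nat by simp
    have c: "coprime (nat (u mod int p)) p"
      using assms(2) n0 coprime_int_iff[of "nat (u mod int p)" p] by simp
    have "[nat (u mod int p) ^ totient p = 1] (mod p)"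
      using c by (rule euler_theorem)
    hence "[int (nat (u mod int p)) ^ totient p = 1] (mod int p)"
      by (metis cong_int_iff of_nat_1 of_nat_power)
    moreover have "int (nat (u mod int p)) = u mod int p" using n0 by simp
    ultimately show ?thesis by (simp add: cong_def power_mod)
  qed
  thus ?thesis using assms(1) by (simp add: totient_prime cong_iff_dvd_diff)
qed

lemma fermat_quotient_unique:
  fixes p :: nat and u q :: int
  assumes "prime p"
  shows "q = fermat_quotient p u \<longleftrightarrow>
    [q = (u ^ (p - 1) - 1) div int p] (mod int p) \<and> 0 \<le> q \<and> q \<le> int p - 1"
proof -
  have "int p > 0" using assms prime_gt_0_nat by simp
  thus ?thesis unfolding fermat_quotient_def cong_def
    by (auto simp: mod_pos_pos_trivial)
qed

definition fermat_sum :: "nat \<Rightarrow> int \<Rightarrow> nat \<Rightarrow> complex" where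
  "fermat_sum p a M = (\<Sum>n | n \<in> {1..M} \<and> coprime n p.
     exp (2 * of_real pi * \<i> * of_int a * of_int (fermat_quotient p (int n)) / of_nat p))"

text \<open>The sum depends on \<open>a\<close> only modulo \<open>p\<close>, so that the maximum over all integers \<open>a\<close>
  coprime to \<open>p\<close> is a \<open>Max\<close> of a finite nonempty set.\<close>

lemma fermat_sum_mod:
  assumes "p > 0"
  shows "fermat_sum p (a mod int p) M = fermat_sum p a M"
  unfolding fermat_sum_def
proof (rule sum.cong[OF refl])
  fix n
  define q where "q = fermat_quotient p (int n)"
  define k where "k = a div int p"
  have a: "a = a mod int p + k * int p" by (simp add: k_def)
  have "2 * of_real pi * \<i> * of_int a * of_int q / of_nat p =
      2 * of_real pi * \<i> * of_int (a mod int p) * of_int q / of_nat p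
      + \<i> * (of_int (k * q) * (of_real pi * 2))"
    using assms by (subst a) (simp add: field_simps)
  thus "exp (2 * of_real pi * \<i> * of_int (a mod int p) * of_int q / of_nat p) =
        exp (2 * of_real pi * \<i> * of_int a * of_int q / of_nat p)"
    by (simp only: exp_plus_2pin)
qed

lemma fermat_sum_max_wf:
  assumes "p > 0"
  shows "finite ((\<lambda>a. norm (fermat_sum p a M) ^ k) ` {a :: int. coprime a (int p)})"
    and "(\<lambda>a. norm (fermat_sum p a M) ^ k) ` {a :: int. coprime a (int p)} \<noteq> {}"
proof -
  have "(\<lambda>a. norm (fermat_sum p a M) ^ k) ` {a :: int. coprime a (int p)}
      \<subseteq> (\<lambda>a. norm (fermat_sum p a M) ^ k) ` {0..<int p}"
  proof (rule image_subsetI)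
    fix a :: int
    have "norm (fermat_sum p a M) ^ k = norm (fermat_sum p (a mod int p) M) ^ k"
      using fermat_sum_mod[OF assms] by simp
    moreover have "a mod int p \<in> {0..<int p}" using assms by simp
    ultimately show "norm (fermat_sum p a M) ^ k
        \<in> (\<lambda>a. norm (fermat_sum p a M) ^ k) ` {0..<int p}" by blast
  qed
  thus "finite ((\<lambda>a. norm (fermat_sum p a M) ^ k) ` {a :: int. coprime a (int p)})"
    by (rule finite_subset) simp
  have "(1::int) \<in> {a. coprime a (int p)}" by simp
  thus "(\<lambda>a. norm (fermat_sum p a M) ^ k) ` {a :: int. coprime a (int p)} \<noteq> {}" by blast
qed

end

theory Submission
  imports Defs
begin

text \<open>Let \<open>\<chi>\<^sub>p(n) = e(a\<^sub>p q\<^sub>p(n) / p)\<close>, where \<open>a\<^sub>p\<close> attains the maximum. This is a primitive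
  character modulo \<open>p\<^sup>2\<close>, and there are only at most \<open>P\<close> of them, so that duality in the style of
  Halasz and Montgomery is strong enough. With a Fejer weight, whose Fourier transform is
  nonnegative, the correlations of \<open>\<chi>\<^sub>p\<close> and \<open>\<chi>\<^sub>q\<close> for \<open>p \<noteq> q\<close> over \<open>n \<le> M\<close> are
  \<open>O(pq + M / (pq))\<close>: the Fourier coefficients of \<open>\<chi>\<^sub>p\<close> are at most \<open>1 / p\<close> and the frequencies
  \<open>h / p\<^sup>2 - k / q\<^sup>2\<close> are distinct fractions with denominator \<open>p\<^sup>2 q\<^sup>2\<close>. Hence
  \<open>\<Sum>\<^sub>p |\<Sum>\<^sub>n c\<^sub>n \<chi>\<^sub>p(n)|\<^sup>2\<close> is \<open>O((M + P\<^sup>3) \<Sum>\<^sub>n c\<^sub>n\<^sup>2)\<close>. For the \<open>\<nu>\<close>-th power of a sum over an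
  interval \<open>I\<close> the coefficients are bounded by \<open>d(n)\<^sup>\<nu>\<close>, and a sum whose length \<open>N\<^sub>p\<close> depends on \<open>p\<close>
  is cut into dyadic blocks, over all of which one can sum because \<open>\<nu> \<ge> 1\<close>. The minimum in the
  bound is thus only an additional nonnegative term.\<close>

subsection \<open>The characters given by Fermat quotients\<close>

text \<open>This is the additive character e(k / m) of the integers modulo \<open>m\<close>.\<close>

definition ee :: "int \<Rightarrow> nat \<Rightarrow> complex" where
  "ee k m = cis (2 * pi * real_of_int k / real m)"

lemma ee_add: "ee (k + l) m = ee k m * ee l m"
  by (simp add: ee_def cis_mult add_divide_distrib algebra_simps)

lemma ee_0 [simp]: "ee 0 m = 1"
  by (simp add: ee_def)

lemma norm_ee [simp]: "norm (ee k m) = 1"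
  by (simp add: ee_def)

lemma cnj_ee: "cnj (ee k m) = ee (- k) m"
  by (simp add: ee_def cis_cnj)

lemma ee_power: "ee k m ^ n = ee (k * int n) m"
  by (simp add: ee_def Complex.DeMoivre mult_ac)

lemma ee_cong:
  assumes "[k = l] (mod int m)"
  shows "ee k m = ee l m"
proof (cases "m = 0")
  case True
  thus ?thesis by (simp add: ee_def)
next
  case False
  obtain t where t: "k = l + int m * t"
    using assms by (metis cong_iff_lin mult.commute cong_sym)
  have "2 * pi * real_of_int (int m * t) / real m = 2 * pi * real_of_int t"
    using False by simp
  hence "ee (int m * t) m = 1"
    unfolding ee_def by (simp only: cis_multiple_2pi Ints_of_int)
  thus ?thesis by (simp add: t ee_add)
qed

lemma ee_eq_1_iff:
  assumes "m > 0"
  shows "ee k m = 1 \<longleftrightarrow> int m dvd k"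
proof
  assume "ee k m = 1"
  hence "cos (2 * pi * real_of_int k / real m) = 1"
    by (metis cis.simps(1) ee_def one_complex.simps(1))
  then obtain n :: int where "2 * pi * real_of_int k / real m = of_int n * 2 * pi"
    using cos_one_2pi_int by blast
  hence "real_of_int k = of_int n * real m" using assms by (simp add: field_simps)
  hence "k = n * int m" by (metis of_int_eq_iff of_int_mult of_int_of_nat_eq)
  thus "int m dvd k" by simp
next
  assume "int m dvd k"
  thus "ee k m = 1" using ee_cong[of k 0 m] by (simp add: cong_0_iff)
qed

text \<open>Orthogonality of additive characters: unless \<open>ee k m\<close> is 1, the geometric
  series vanishes because \<open>ee k m ^ m = 1\<close>.\<close>

lemma sum_ee:
  assumes "m > 0"
  shows "(\<Sum>n<m. ee (k * int n) m) = (if int m dvd k then of_nat m else 0)"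
proof (cases "int m dvd k")
  case True
  hence "ee (k * int n) m = 1" for n using ee_eq_1_iff[OF assms] by simp
  thus ?thesis using True by simp
next
  case False
  have "(1 - ee k m) * (\<Sum>n<m. ee k m ^ n) = 1 - ee k m ^ m"
    by (simp add: one_diff_power_eq)
  also have "ee k m ^ m = 1" using ee_eq_1_iff[OF assms] by (simp add: ee_power)
  finally show ?thesis using False ee_eq_1_iff[OF assms, of k] by (auto simp: ee_power)
qed

text \<open>Extended by zero, this is a Dirichlet character modulo the square of \<open>p\<close>.
  Its argument is an integer because differences \<open>int x - int y\<close> of either sign are
  inserted later.\<close>

definition chi :: "nat \<Rightarrow> int \<Rightarrow> int \<Rightarrow> complex" where
  "chi p a n = (if coprime n (int p) then ee (a * fermat_quotient p n) p else 0)"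

text \<open>Starting the index at 0 gives a prefix sum, the form that the dyadic decomposition
  uses.\<close>

lemma fermat_sum_eq_chi: "fermat_sum p a M = (\<Sum>n<M. chi p a (int n + 1))"
proof -
  have "fermat_sum p a M = (\<Sum>n | n \<in> {1..M} \<and> coprime n p. ee (a * fermat_quotient p (int n)) p)"
    unfolding fermat_sum_def
    by (intro sum.cong refl) (simp add: ee_def cis_conv_exp mult_ac)
  also have "\<dots> = (\<Sum>n\<in>{1..M}. chi p a (int n))"
    by (intro sum.mono_neutral_cong_left) (auto simp: chi_def)
  also have "\<dots> = (\<Sum>n<M. chi p a (int n + 1))"
    by (rule sum.reindex_bij_witness[of _ "\<lambda>n. n + 1" "\<lambda>n. n - 1"]) auto
  finally show ?thesis .
qed

lemma fermat_quotient_cong: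
  assumes "p > 0" "u ^ (p - 1) - 1 = int p * A"
  shows "[fermat_quotient p u = A] (mod int p)"
  using assms by (simp add: fermat_quotient_def cong_def)

text \<open>If the powers of \<open>u\<close> and \<open>v\<close> are 1 + pA and 1 + pB, then their
  product is 1 + p(A + B) modulo the square of p: the Fermat quotient behaves like a
  logarithm.\<close>

lemma fermat_quotient_mult:
  assumes "prime p" "coprime u (int p)" "coprime v (int p)"
  shows "[fermat_quotient p (u * v) = fermat_quotient p u + fermat_quotient p v] (mod int p)"
proof -
  have p: "p > 0" using assms(1) prime_gt_0_nat by simp
  obtain A where A: "u ^ (p - 1) - 1 = int p * A"
    using fermat_quotient_exact[OF assms(1,2)] by blast
  obtain B where B: "v ^ (p - 1) - 1 = int p * B"
    using fermat_quotient_exact[OF assms(1,3)] by blast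
  have "(u * v) ^ (p - 1) - 1 = (1 + int p * A) * (1 + int p * B) - 1"
    by (simp add: power_mult_distrib flip: A B)
  also have "\<dots> = int p * (A + B + int p * (A * B))"
    by (simp add: algebra_simps)
  finally have "[fermat_quotient p (u * v) = A + B + int p * (A * B)] (mod int p)"
    by (rule fermat_quotient_cong[OF p])
  also have "[A + B + int p * (A * B) = A + B] (mod int p)" by (simp add: cong_def)
  also have "[A + B = fermat_quotient p u + fermat_quotient p v] (mod int p)"
    using fermat_quotient_cong[OF p A] fermat_quotient_cong[OF p B] cong_add cong_sym by blast
  finally show ?thesis .
qed

text \<open>A first-order Taylor expansion; \<open>t\<close> collects everything of second order in
  \<open>d\<close>.\<close>

lemma power_add_multiple:
  fixes u d v :: int
  shows "\<exists>t. (u + d * v) ^ n = u ^ n + int n * u ^ (n - 1) * d * v + d * d * t"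
proof (induction n)
  case (Suc n)
  then obtain t where t: "(u + d * v) ^ n = u ^ n + int n * u ^ (n - 1) * d * v + d * d * t" by blast
  \<comment> \<open>For \<open>n = 0\<close> the truncated exponent \<open>n - 1\<close> is
    harmless, since the factor \<open>n\<close> vanishes.\<close>
  have s: "int n * u ^ n = int n * (u * u ^ (n - 1))" by (cases n) auto
  have "(u + d * v) ^ Suc n = (u + d * v) * (u ^ n + int n * u ^ (n - 1) * d * v + d * d * t)"
    by (simp add: t)
  also have "\<dots> = u ^ Suc n + u ^ n * d * v + int n * (u * u ^ (n - 1)) * d * v
       + d * d * (int n * u ^ (n - 1) * v * v + t * (u + d * v))"
    by (simp add: algebra_simps)
  also have "\<dots> = u ^ Suc n + int (Suc n) * u ^ (Suc n - 1) * d * v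
       + d * d * (int n * u ^ (n - 1) * v * v + t * (u + d * v))"
    unfolding s[symmetric] by (simp add: algebra_simps)
  finally show ?case by blast
qed (intro exI[of _ 0], simp)

text \<open>The derivative of the power \<open>p - 1\<close> is (p - 1) u^(p-2), which is -u^(p-2)
  modulo p; after division by p only this linear term in \<open>v\<close> survives.\<close>

lemma fermat_quotient_shift:
  assumes "prime p" "coprime u (int p)"
  shows "[fermat_quotient p (u + int p * v) = fermat_quotient p u - u ^ (p - 2) * v] (mod int p)"
proof -
  have p: "p > 0" using assms(1) prime_gt_0_nat by simp
  obtain A where A: "u ^ (p - 1) - 1 = int p * A"
    using fermat_quotient_exact[OF assms] by blast
  obtain t where t: "(u + int p * v) ^ (p - 1)
      = u ^ (p - 1) + int (p - 1) * u ^ (p - 1 - 1) * int p * v + int p * int p * t"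
    using power_add_multiple by blast
  have p2: "p - 1 - 1 = p - 2" "int (p - 1) = int p - 1" using p by auto
  have "(u + int p * v) ^ (p - 1) - 1
      = (u ^ (p - 1) - 1) + (int p - 1) * u ^ (p - 2) * int p * v + int p * int p * t"
    unfolding t p2 by simp
  also have "\<dots> = int p * (A - u ^ (p - 2) * v + int p * (u ^ (p - 2) * v + t))"
    unfolding A by (simp add: algebra_simps)
  finally have "[fermat_quotient p (u + int p * v)
      = A - u ^ (p - 2) * v + int p * (u ^ (p - 2) * v + t)] (mod int p)"
    by (rule fermat_quotient_cong[OF p])
  also have "[A - u ^ (p - 2) * v + int p * (u ^ (p - 2) * v + t) = A - u ^ (p - 2) * v] (mod int p)"
    by (simp add: cong_def)
  also have "[A - u ^ (p - 2) * v = fermat_quotient p u - u ^ (p - 2) * v] (mod int p)"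
    using fermat_quotient_cong[OF p A] cong_diff cong_sym cong_refl by blast
  finally show ?thesis .
qed

lemma chi_mult:
  assumes "prime p"
  shows "chi p a (u * v) = chi p a u * chi p a v"
proof (cases "coprime u (int p) \<and> coprime v (int p)")
  case True
  have "ee (a * fermat_quotient p (u * v)) p = ee (a * (fermat_quotient p u + fermat_quotient p v)) p"
    using True assms fermat_quotient_mult by (intro ee_cong cong_scalar_left) auto
  thus ?thesis using True by (simp add: chi_def ee_add algebra_simps)
qed (auto simp: chi_def)

lemma chi_1: "prime p \<Longrightarrow> chi p a 1 = 1"
  by (simp add: chi_def fermat_quotient_def)

text \<open>Within one residue class modulo \<open>p\<close> the multiplicative character thus
  becomes an additive one in \<open>v\<close>. Both the period and the Gauss sum bound rest on
  this.\<close>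

lemma chi_shift:
  assumes "prime p"
  shows "chi p a (u + int p * v) = chi p a u * ee (- (a * u ^ (p - 2)) * v) p"
proof -
  have c: "coprime (u + int p * v) (int p) \<longleftrightarrow> coprime u (int p)"
    using gcd_add_mult[of "int p" v u]
    by (simp add: coprime_iff_gcd_eq_1 gcd.commute[of _ "int p"] add.commute mult.commute)
  show ?thesis
  proof (cases "coprime u (int p)")
    case True
    have "ee (a * fermat_quotient p (u + int p * v)) p
        = ee (a * (fermat_quotient p u - u ^ (p - 2) * v)) p"
      using True assms fermat_quotient_shift by (intro ee_cong cong_scalar_left) auto
    thus ?thesis using True c by (simp add: chi_def algebra_simps flip: ee_add)
  qed (use c in \<open>auto simp: chi_def\<close>)
qed

lemma norm_chi_le: "norm (chi p a n) \<le> 1"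
  by (simp add: chi_def)

text \<open>A shift by a multiple of the square of \<open>p\<close> makes the additive factor in
  \<open>chi_shift\<close> trivial.\<close>

lemma chi_cong:
  assumes "prime p" "[m = n] (mod int p ^ 2)"
  shows "chi p a m = chi p a n"
proof -
  obtain t where t: "m = n + int p * (int p * t)"
    using assms(2) by (metis cong_iff_lin mult.commute cong_sym power2_eq_square mult.assoc)
  have "ee (- (a * n ^ (p - 2)) * (int p * t)) p = 1"
    using assms(1) prime_gt_0_nat by (subst ee_eq_1_iff) auto
  thus ?thesis unfolding t chi_shift[OF assms(1)] by simp
qed

section \<open>Gauss sums and the finite Fourier expansion of the characters\<close>

definition gauss_sum :: "nat \<Rightarrow> int \<Rightarrow> int \<Rightarrow> complex" where
  "gauss_sum p a h = (\<Sum>m<p\<^sup>2. chi p a (int m) * ee (- h * int m) (p\<^sup>2))"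

text \<open>Write m = u + pv. By \<open>chi_shift\<close> the sum over v is p or 0, and it is p for
  at most one u that is coprime to p. This is square root cancellation for the modulus p^2.\<close>

lemma norm_gauss_sum_le:
  assumes "prime p" "coprime a (int p)"
  shows "norm (gauss_sum p a h) \<le> real p"
proof -
  have p: "p > 0" using assms(1) prime_gt_0_nat by simp
  \<comment> \<open>\<open>z u\<close> is the frequency of the sum over \<open>v\<close>, which
    survives only if \<open>p\<close> divides \<open>z u\<close>.\<close>
  define z where "z u = - (a * int u ^ (p - 2)) - h" for u
  define t where "t u v = chi p a (int u) * ee (- h * int u) (p\<^sup>2) * ee (z u * int v) p" for u v
  have summand: "chi p a (int (u + p * v)) * ee (- h * int (u + p * v)) (p\<^sup>2) = t u v" for u v
  proof -
    have "ee (- h * int v * int p) (p\<^sup>2) = ee (- h * int v) p"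
      using p by (simp add: ee_def power2_eq_square mult_ac)
    moreover have "- h * int (u + p * v) = - h * int u + - h * int v * int p"
      by (simp add: algebra_simps)
    ultimately have "ee (- h * int (u + p * v)) (p\<^sup>2) = ee (- h * int u) (p\<^sup>2) * ee (- h * int v) p"
      by (simp only: ee_add)
    moreover have "chi p a (int (u + p * v)) = chi p a (int u) * ee (- (a * int u ^ (p - 2)) * int v) p"
      using chi_shift[OF assms(1), of a "int u" "int v"] by simp
    moreover have "ee (z u * int v) p = ee (- (a * int u ^ (p - 2)) * int v) p * ee (- h * int v) p"
      unfolding ee_add[symmetric]
      by (rule arg_cong[of _ _ "\<lambda>k. ee k p"]) (simp add: z_def algebra_simps)
    ultimately show ?thesis by (simp add: t_def)
  qed
  have "gauss_sum p a h = (\<Sum>v<p. \<Sum>m\<in>{v * p..<v * p + p}. chi p a (int m) * ee (- h * int m) (p\<^sup>2))"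
    unfolding gauss_sum_def power2_eq_square by (subst sum.nat_group) simp
  also have "\<dots> = (\<Sum>v<p. \<Sum>u<p. t u v)"
  proof (rule sum.cong[OF refl])
    fix v
    show "(\<Sum>m\<in>{v * p..<v * p + p}. chi p a (int m) * ee (- h * int m) (p\<^sup>2)) = (\<Sum>u<p. t u v)"
      using sum.shift_bounds_nat_ivl[of "\<lambda>m. chi p a (int m) * ee (- h * int m) (p\<^sup>2)" 0 "v * p" p]
      by (simp only: summand[symmetric] lessThan_atLeast0 mult.commute[of p v] add_0_left add.commute[of p])
  qed
  also have "\<dots> = (\<Sum>u<p. \<Sum>v<p. t u v)" by (rule sum.swap)
  also have "\<dots> = (\<Sum>u<p. chi p a (int u) * ee (- h * int u) (p\<^sup>2) * (if int p dvd z u then of_nat p else 0))"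
    by (simp add: t_def sum_ee[OF p] flip: sum_distrib_left)
  also have "norm \<dots> \<le> (\<Sum>u<p. if coprime (int u) (int p) \<and> int p dvd z u then real p else 0)"
    by (rule sum_norm_le) (auto simp: norm_mult chi_def)
  also have "\<dots> = real p * card {u \<in> {..<p}. coprime (int u) (int p) \<and> int p dvd z u}"
    by (simp flip: sum.inter_filter)
  also have "card {u \<in> {..<p}. coprime (int u) (int p) \<and> int p dvd z u} \<le> 1"
  proof (rule card_le_Suc0_iff_eq[THEN iffD2, folded One_nat_def], simp, intro ballI)
    \<comment> \<open>Multiplying \<open>z u\<close> by \<open>u\<close> and using u^(p-1) = 1
      modulo p turns the condition into a linear congruence.\<close>
    have key: "[- a = h * int u] (mod int p)" if "coprime (int u) (int p)" "int p dvd z u" for u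
    proof -
      have "p \<ge> 2" using assms(1) prime_ge_2_nat by blast
      hence "Suc (p - 2) = p - 1" by simp
      hence "int u * int u ^ (p - 2) = int u ^ (p - 1)" by (metis power_Suc)
      moreover have "int u * z u = - a * (int u * int u ^ (p - 2)) - h * int u"
        by (simp add: z_def algebra_simps)
      ultimately have "- a - h * int u = int u * z u + a * (int u ^ (p - 1) - 1)"
        by (simp add: algebra_simps)
      also have "int p dvd \<dots>"
        using that fermat_quotient_exact[OF assms(1) that(1)] by simp
      finally show ?thesis by (simp add: cong_iff_dvd_diff)
    qed
    fix u v assume u: "u \<in> {u \<in> {..<p}. coprime (int u) (int p) \<and> int p dvd z u}"
      and v: "v \<in> {u \<in> {..<p}. coprime (int u) (int p) \<and> int p dvd z u}"
    have "[h * int u = h * int v] (mod int p)"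
      using key[of u] key[of v] u v cong_sym cong_trans by blast
    \<comment> \<open>If \<open>p\<close> divided \<open>h\<close>, the linear congruence would
      force \<open>p\<close> to divide \<open>a\<close>. So \<open>h\<close> can be
      cancelled.\<close>
    moreover have "coprime h (int p)"
    proof (rule ccontr)
      assume "\<not> coprime h (int p)"
      hence "int p dvd h" using assms(1) prime_imp_coprime[of "int p" h] by (auto simp: coprime_commute)
      moreover have "[- a = h * int u] (mod int p)" using key u by blast
      ultimately have "int p dvd - a" using cong_dvd_iff[of "- a" "h * int u" "int p"] by simp
      hence "int p dvd a" by simp
      hence "is_unit (int p)" using coprime_common_divisor[OF assms(2) _ dvd_refl] by blast
      thus False using assms(1) by simp
    qed
    ultimately have "[int u = int v] (mod int p)" by (simp add: cong_mult_lcancel)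
    thus "u = v" using u v by (auto simp: cong_int_iff cong_def)
  qed
  finally show ?thesis using p by (simp add: mult_left_le)
qed

text \<open>Fourier inversion: the sign of \<open>h\<close> in \<open>gauss_sum\<close> makes it the
  unnormalised coefficient at frequency \<open>h\<close>, and orthogonality singles out the residue
  of \<open>n\<close>.\<close>

lemma chi_fourier:
  assumes "prime p"
  shows "chi p a n = (\<Sum>h<p\<^sup>2. gauss_sum p a (int h) / of_nat (p\<^sup>2) * ee (int h * n) (p\<^sup>2))"
proof -
  define Q where "Q = p\<^sup>2"
  have Q: "Q > 0" using assms prime_gt_0_nat by (simp add: Q_def)
  define m0 where "m0 = nat (n mod int Q)"
  have m0: "m0 < Q" "int m0 = n mod int Q" using Q by (auto simp: m0_def nat_less_iff)
  have "(\<Sum>h<Q. gauss_sum p a (int h) * ee (int h * n) Q)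
      = (\<Sum>h<Q. \<Sum>m<Q. chi p a (int m) * ee ((n - int m) * int h) Q)"
    unfolding gauss_sum_def Q_def[symmetric]
  proof (rule sum.cong[OF refl])
    fix h
    have "ee ((n - int m) * int h) Q = ee (- int h * int m) Q * ee (int h * n) Q" for m
      unfolding ee_add[symmetric] by (simp add: algebra_simps)
    thus "(\<Sum>m<Q. chi p a (int m) * ee (- int h * int m) Q) * ee (int h * n) Q
        = (\<Sum>m<Q. chi p a (int m) * ee ((n - int m) * int h) Q)"
      by (simp only: sum_distrib_right mult.assoc)
  qed
  also have "\<dots> = (\<Sum>m<Q. chi p a (int m) * (if int Q dvd n - int m then of_nat Q else 0))"
    by (subst sum.swap) (simp add: sum_ee[OF Q] flip: sum_distrib_left)
  also have "\<dots> = (\<Sum>m<Q. if m = m0 then chi p a (int m) * of_nat Q else 0)"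
  proof (intro sum.cong refl)
    fix m assume m: "m \<in> {..<Q}"
    have "int Q dvd n - int m \<longleftrightarrow> n mod int Q = int m mod int Q" by (simp add: mod_eq_dvd_iff)
    also have "\<dots> \<longleftrightarrow> m = m0" using m m0 by auto
    finally show "chi p a (int m) * (if int Q dvd n - int m then of_nat Q else 0)
        = (if m = m0 then chi p a (int m) * of_nat Q else 0)" by simp
  qed
  also have "\<dots> = chi p a (int m0) * of_nat Q" using m0 by simp
  also have "chi p a (int m0) = chi p a n"
    using m0(2) assms by (intro chi_cong) (auto simp: cong_def Q_def)
  finally show ?thesis using Q unfolding Q_def[symmetric]
    by (simp add: field_simps flip: sum_divide_distrib)
qed

subsection \<open>The large sieve\<close>

text \<open>Elements of one residue class modulo \<open>Q\<close> are told apart by their quotients,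
  which are at most \<open>L div Q\<close>.\<close>

lemma card_cong_le:
  fixes L Q :: nat
  assumes "Q > 0"
  shows "card {y \<in> {..<L}. int Q dvd int x - int y} \<le> L div Q + 1"
proof -
  have "inj_on (\<lambda>y. y div Q) {y \<in> {..<L}. int Q dvd int x - int y}"
  proof (rule inj_onI)
    fix y z assume yz: "y \<in> {y \<in> {..<L}. int Q dvd int x - int y}"
      "z \<in> {y \<in> {..<L}. int Q dvd int x - int y}" and d: "y div Q = z div Q"
    have "int Q dvd int x - int z" "int Q dvd int x - int y" using yz by auto
    hence "int Q dvd (int x - int z) - (int x - int y)" by (rule dvd_diff)
    hence "int y mod int Q = int z mod int Q" by (simp add: mod_eq_dvd_iff)
    hence "y mod Q = z mod Q" by (metis of_nat_eq_iff zmod_int)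
    thus "y = z" using d by (metis div_mult_mod_eq)
  qed
  moreover have "(\<lambda>y. y div Q) ` {y \<in> {..<L}. int Q dvd int x - int y} \<subseteq> {..L div Q}"
    by (auto intro: div_le_mono)
  ultimately show ?thesis using card_inj_on_le[of _ _ "{..L div Q}"] by fastforce
qed

text \<open>This is the Fejer kernel. The double sum over differences is its expanded form, and the
  left-hand side shows that it is nonnegative.\<close>

lemma norm_sum_ee_sq:
  "complex_of_real ((norm (\<Sum>x<L. ee (j * int x) Q))\<^sup>2)
    = (\<Sum>x<L. \<Sum>y<L. ee (j * (int x - int y)) Q)"
  unfolding complex_norm_square
  by (simp add: cnj_ee sum_product algebra_simps flip: ee_add)

text \<open>Summing over all frequencies leaves, by orthogonality, \<open>Q\<close> times the number
  of pairs that are congruent modulo \<open>Q\<close>.\<close>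

lemma sum_norm_sum_ee_sq_le:
  assumes "Q > 0"
  shows "(\<Sum>j<Q. (norm (\<Sum>x<L. ee (int j * int x) Q))\<^sup>2) \<le> real Q * real L * (real L / real Q + 1)"
proof -
  have "complex_of_real (\<Sum>j<Q. (norm (\<Sum>x<L. ee (int j * int x) Q))\<^sup>2)
      = (\<Sum>j<Q. \<Sum>x<L. \<Sum>y<L. ee ((int x - int y) * int j) Q)"
    by (simp only: of_real_sum norm_sum_ee_sq) (simp add: mult.commute)
  also have "\<dots> = (\<Sum>x<L. \<Sum>y<L. \<Sum>j<Q. ee ((int x - int y) * int j) Q)"
    by (subst sum.swap, rule sum.cong[OF refl], rule sum.swap)
  also have "\<dots> = (\<Sum>x<L. of_nat Q * of_nat (card {y \<in> {..<L}. int Q dvd int x - int y}))"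
    by (simp add: sum_ee[OF assms] flip: sum.inter_filter) (simp add: mult.commute)
  also have "\<dots> = complex_of_real (\<Sum>x<L. real Q * real (card {y \<in> {..<L}. int Q dvd int x - int y}))"
    by simp
  finally have "(\<Sum>j<Q. (norm (\<Sum>x<L. ee (int j * int x) Q))\<^sup>2)
      = (\<Sum>x<L. real Q * real (card {y \<in> {..<L}. int Q dvd int x - int y}))"
    using of_real_eq_iff by blast
  also have "\<dots> \<le> (\<Sum>x<L. real Q * (real L / real Q + 1))"
  proof (intro sum_mono mult_left_mono)
    fix x
    have "real (card {y \<in> {..<L}. int Q dvd int x - int y}) \<le> real (L div Q + 1)"
      using card_cong_le[OF assms] of_nat_le_iff by blast
    also have "\<dots> \<le> real L / real Q + 1" using of_nat_div_le_of_nat[of L Q] by simp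
    finally show "real (card {y \<in> {..<L}. int Q dvd int x - int y}) \<le> real L / real Q + 1" .
  qed simp
  finally show ?thesis by (simp only: sum_constant card_lessThan mult_ac)
qed

text \<open>Expanding both characters gives coefficients of size at most 1 / (pq) at distinct
  frequencies modulo \<open>Q\<close>. As the Fejer kernel is nonnegative, the sum of its values at
  these frequencies is at most its sum over all frequencies.\<close>

lemma chi_correlation_le:
  assumes "prime p" "prime q" "p \<noteq> q" "coprime a (int p)" "coprime b (int q)"
  shows "norm (\<Sum>x<L. \<Sum>y<L. chi p a (int x - int y) * cnj (chi q b (int x - int y)))
    \<le> real p * real q * real L * (real L / (real p * real q)\<^sup>2 + 1)"
proof -
  have pq: "p > 0" "q > 0" using assms prime_gt_0_nat by auto
  define Q where "Q = p\<^sup>2 * q\<^sup>2"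
  have Q: "Q > 0" using pq by (simp add: Q_def)
  define H where "H = {..<p\<^sup>2} \<times> {..<q\<^sup>2}"
  define C where "C = (\<lambda>(h, k). gauss_sum p a (int h) / of_nat (p\<^sup>2) * cnj (gauss_sum q b (int k) / of_nat (q\<^sup>2)))"
  \<comment> \<open>The numerator of h / p^2 - k / q^2 over the common denominator
    \<open>Q\<close>.\<close>
  define j where "j = (\<lambda>(h, k). int h * int (q\<^sup>2) - int k * int (p\<^sup>2))"
  define W where "W l = (norm (\<Sum>x<L. ee (l * int x) Q))\<^sup>2" for l
  have expand: "chi p a n * cnj (chi q b n) = (\<Sum>hk\<in>H. C hk * ee (j hk * n) Q)" for n
  proof -
    have e1: "ee (int h * n) (p\<^sup>2) = ee (int h * int (q\<^sup>2) * n) Q" for h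
      using pq by (simp add: ee_def Q_def mult_ac)
    have e2: "cnj (ee (int k * n) (q\<^sup>2)) = ee (- (int k * int (p\<^sup>2)) * n) Q" for k
      using pq by (simp add: ee_def Q_def cis_cnj mult_ac)
    have "chi p a n * cnj (chi q b n) = (\<Sum>h<p\<^sup>2. \<Sum>k<q\<^sup>2.
       (gauss_sum p a (int h) / of_nat (p\<^sup>2) * ee (int h * n) (p\<^sup>2)) *
       (cnj (gauss_sum q b (int k) / of_nat (q\<^sup>2)) * cnj (ee (int k * n) (q\<^sup>2))))"
      unfolding chi_fourier[OF assms(1)] chi_fourier[OF assms(2)] cnj_sum sum_product
        complex_cnj_mult ..
    also have "\<dots> = (\<Sum>h<p\<^sup>2. \<Sum>k<q\<^sup>2. C (h, k) * ee (j (h, k) * n) Q)"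
    proof (intro sum.cong refl)
      fix h k
      have "ee (j (h, k) * n) Q = ee (int h * int (q\<^sup>2) * n) Q * ee (- (int k * int (p\<^sup>2)) * n) Q"
        unfolding ee_add[symmetric] j_def by (simp add: algebra_simps)
      thus "(gauss_sum p a (int h) / of_nat (p\<^sup>2) * ee (int h * n) (p\<^sup>2)) *
         (cnj (gauss_sum q b (int k) / of_nat (q\<^sup>2)) * cnj (ee (int k * n) (q\<^sup>2)))
         = C (h, k) * ee (j (h, k) * n) Q"
        unfolding e1 e2 C_def by (simp only: prod.case mult_ac)
    qed
    also have "\<dots> = (\<Sum>hk\<in>H. C hk * ee (j hk * n) Q)"
      unfolding H_def by (simp add: sum.cartesian_product case_prod_unfold)
    finally show ?thesis .
  qed
  have C_le: "norm (C hk) \<le> 1 / (real p * real q)" for hk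
  proof -
    obtain h k where hk: "hk = (h, k)" by force
    have "norm (gauss_sum p a (int h)) / (real p)\<^sup>2 \<le> real p / (real p)\<^sup>2"
      using norm_gauss_sum_le[OF assms(1,4)] by (intro divide_right_mono) auto
    moreover have "norm (gauss_sum q b (int k)) / (real q)\<^sup>2 \<le> real q / (real q)\<^sup>2"
      using norm_gauss_sum_le[OF assms(2,5)] by (intro divide_right_mono) auto
    ultimately have "norm (gauss_sum p a (int h)) / (real p)\<^sup>2 * (norm (gauss_sum q b (int k)) / (real q)\<^sup>2)
        \<le> real p / (real p)\<^sup>2 * (real q / (real q)\<^sup>2)"
      by (intro mult_mono) auto
    also have "\<dots> = 1 / (real p * real q)" using pq by (simp add: power2_eq_square)
    finally show ?thesis by (simp add: hk C_def norm_mult norm_divide norm_power)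
  qed
  \<comment> \<open>The uniqueness half of the Chinese remainder theorem: \<open>j\<close> modulo
    \<open>p\<^sup>2\<close> determines \<open>h\<close>, and modulo \<open>q\<^sup>2\<close> it
    determines \<open>k\<close>.\<close>
  have inj: "inj_on (\<lambda>hk. nat (j hk mod int Q)) H"
  proof (rule inj_onI)
    fix x y assume xy: "x \<in> H" "y \<in> H" "nat (j x mod int Q) = nat (j y mod int Q)"
    obtain h k where x: "x = (h, k)" by force
    obtain h' k' where y: "y = (h', k')" by force
    have "j x mod int Q = j y mod int Q" using xy(3) Q
      by (metis Euclidean_Rings.pos_mod_sign nat_eq_iff of_nat_0_less_iff)
    hence d: "int Q dvd j x - j y" by (simp add: mod_eq_dvd_iff)
    have e: "j x - j y = (int h - int h') * int (q\<^sup>2) - (int k - int k') * int (p\<^sup>2)"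
      by (simp add: x y j_def algebra_simps)
    have "coprime p q" using assms primes_coprime by blast
    hence cop: "coprime (int (p\<^sup>2)) (int (q\<^sup>2))" by simp
    have "int (p\<^sup>2) dvd j x - j y" using d dvd_mult_left by (auto simp: Q_def)
    hence "int (p\<^sup>2) dvd (int h - int h') * int (q\<^sup>2)"
      unfolding e by (metis dvd_diff_right_iff dvd_triv_right diff_add_cancel dvd_add)
    hence "int (p\<^sup>2) dvd int h - int h'" using cop coprime_dvd_mult_left_iff by blast
    hence "int h mod int (p\<^sup>2) = int h' mod int (p\<^sup>2)" by (simp add: mod_eq_dvd_iff)
    hence "h = h'" using xy by (simp add: x y H_def flip: of_nat_power)
    have "int (q\<^sup>2) dvd j x - j y" using d dvd_mult_right by (auto simp: Q_def)
    hence "int (q\<^sup>2) dvd (int k - int k') * int (p\<^sup>2)"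
      using \<open>h = h'\<close> unfolding e by simp
    hence "int (q\<^sup>2) dvd int k - int k'"
      using cop coprime_dvd_mult_left_iff coprime_commute by blast
    hence "int k mod int (q\<^sup>2) = int k' mod int (q\<^sup>2)" by (simp add: mod_eq_dvd_iff)
    hence "k = k'" using xy by (simp add: x y H_def flip: of_nat_power)
    show "x = y" using \<open>h = h'\<close> \<open>k = k'\<close> x y by simp
  qed
  have W_mod: "W (j hk) = W (int (nat (j hk mod int Q)))" for hk
  proof -
    have "ee (j hk * int x) Q = ee (int (nat (j hk mod int Q)) * int x) Q" for x
      using Q by (intro ee_cong cong_scalar_right) (simp add: cong_def)
    thus ?thesis by (simp add: W_def)
  qed
  have "(\<Sum>x<L. \<Sum>y<L. chi p a (int x - int y) * cnj (chi q b (int x - int y)))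
      = (\<Sum>hk\<in>H. C hk * (\<Sum>x<L. \<Sum>y<L. ee (j hk * (int x - int y)) Q))"
    unfolding expand sum_distrib_left
    by (subst sum.swap[of _ _ H], rule sum.cong[OF refl], subst sum.swap, rule refl)
  also have "\<dots> = (\<Sum>hk\<in>H. C hk * complex_of_real (W (j hk)))"
    by (simp only: W_def norm_sum_ee_sq)
  also have "norm \<dots> \<le> (\<Sum>hk\<in>H. 1 / (real p * real q) * W (j hk))"
  proof (rule sum_norm_le)
    fix hk
    have "W (j hk) \<ge> 0" by (simp add: W_def)
    thus "norm (C hk * complex_of_real (W (j hk))) \<le> 1 / (real p * real q) * W (j hk)"
      unfolding norm_mult norm_of_real using C_le[of hk] by (simp add: mult_right_mono del: mult_1_left times_divide_eq_left)
  qed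
  also have "\<dots> = 1 / (real p * real q) * (\<Sum>hk\<in>H. W (int (nat (j hk mod int Q))))"
    unfolding sum_distrib_left using W_mod by simp
  also have "(\<Sum>hk\<in>H. W (int (nat (j hk mod int Q)))) = (\<Sum>l\<in>(\<lambda>hk. nat (j hk mod int Q)) ` H. W (int l))"
    by (simp add: sum.reindex[OF inj])
  \<comment> \<open>Frequencies not of the form \<open>j hk\<close> may be added because
    \<open>W\<close> is nonnegative.\<close>
  also have "\<dots> \<le> (\<Sum>l<Q. W (int l))"
    using Q by (intro sum_mono2) (auto simp: W_def nat_less_iff)
  also have "\<dots> \<le> real Q * real L * (real L / real Q + 1)"
    unfolding W_def by (rule sum_norm_sum_ee_sq_le[OF Q])
  also have "1 / (real p * real q) * (real Q * real L * (real L / real Q + 1))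
      = real p * real q * real L * (real L / (real p * real q)\<^sup>2 + 1)"
    using pq by (simp add: Q_def power2_eq_square field_simps)
  finally show ?thesis using pq by (simp add: mult_left_mono divide_right_mono)
qed

text \<open>Duality: \<open>S\<close> is a sum of \<open>c n\<close> against \<open>G\<close>, so
  Cauchy-Schwarz reduces it to the mean square of \<open>G\<close>. Expanding that square produces
  the correlations \<open>T p q\<close> and returns a multiple of \<open>S\<close>, which is then
  cancelled.\<close>

lemma large_sieve_chi:
  fixes c :: "nat \<Rightarrow> real"
  assumes P: "P \<ge> 1" and M: "M \<ge> 1"
    and J: "J \<subseteq> {p. prime p \<and> P < p \<and> p \<le> 2 * P}" and a: "\<And>p. p \<in> J \<Longrightarrow> coprime (a p) (int p)"
  shows "(\<Sum>p\<in>J. (norm (\<Sum>n=1..M. of_real (c n) * chi p (a p) (int n)))\<^sup>2)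
     \<le> (8 * real M + 8 * real P ^ 3) * (\<Sum>n=1..M. (c n)\<^sup>2)"
proof -
  have "J \<subseteq> {P<..2 * P}" using J by auto
  hence finJ: "finite J" and cardJ: "card J \<le> P"
    using finite_subset card_mono[of "{P<..2 * P}" J] by auto
  define A where "A p = (\<Sum>n=1..M. of_real (c n) * chi p (a p) (int n))" for p
  define S where "S = (\<Sum>p\<in>J. (norm (A p))\<^sup>2)"
  define G where "G n = (\<Sum>p\<in>J. cnj (A p) * chi p (a p) n)" for n
  define T where "T p q = (\<Sum>x<2*M. \<Sum>y<2*M. chi p (a p) (int x - int y) * cnj (chi q (a q) (int x - int y)))" for p q
  \<comment> \<open>From \<open>chi_correlation_le\<close> with \<open>L = 2 * M\<close>, where pq
    lies between P^2 and 4 P^2.\<close>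
  define E where "E = real M * (4 * real M / (real P)\<^sup>2 + 8 * (real P)\<^sup>2)"
  have E0: "E \<ge> 0" by (simp add: E_def)
  have S0: "S \<ge> 0" by (simp add: S_def sum_nonneg)
  \<comment> \<open>Allowing \<open>E\<close> on the diagonal too makes its total contribution the
    full square of the sum of the \<open>norm (A p)\<close>.\<close>
  have T_le: "norm (T p q) \<le> (if p = q then 4 * (real M)\<^sup>2 else 0) + E" if "p \<in> J" "q \<in> J" for p q
  proof (cases "p = q")
    case True
    have "norm (T p q) \<le> (\<Sum>x<2*M. \<Sum>y<2*M. 1)"
      unfolding T_def
      by (intro sum_norm_le) (simp add: norm_mult mult_le_one norm_chi_le)
    thus ?thesis using True E0 by (simp add: power2_eq_square)
  next
    case False
    have pq: "prime p" "prime q" "P < p" "P < q" "p \<le> 2 * P" "q \<le> 2 * P" using that J by auto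
    have lo: "(real P)\<^sup>2 \<le> real p * real q"
      unfolding power2_eq_square using pq by (intro mult_mono) auto
    have "real p * real q \<le> (2 * real P) * (2 * real P)" using pq by (intro mult_mono) auto
    hence hi: "real p * real q \<le> 4 * (real P)\<^sup>2" by (simp add: power2_eq_square)
    have P0: "(real P)\<^sup>2 > 0" "real p * real q > 0" using P pq by auto
    have "norm (T p q) \<le> real p * real q * real (2 * M) * (real (2 * M) / (real p * real q)\<^sup>2 + 1)"
      unfolding T_def using pq that a False by (intro chi_correlation_le) auto
    also have "\<dots> = real M * (4 * real M / (real p * real q) + 2 * (real p * real q))"
      using pq by (simp add: field_simps power2_eq_square)
    also have "\<dots> \<le> real M * (4 * real M / (real P)\<^sup>2 + 2 * (4 * (real P)\<^sup>2))"
      using lo hi P0 by (intro mult_left_mono add_mono divide_left_mono) auto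
    finally show ?thesis using False by (simp add: E_def)
  qed
  have S_eq: "complex_of_real S = (\<Sum>n=1..M. of_real (c n) * G (int n))"
  proof -
    have "complex_of_real S = (\<Sum>p\<in>J. cnj (A p) * A p)"
      unfolding S_def of_real_sum complex_norm_square by (simp add: mult.commute)
    also have "\<dots> = (\<Sum>p\<in>J. \<Sum>n=1..M. of_real (c n) * (cnj (A p) * chi p (a p) (int n)))"
    proof (rule sum.cong[OF refl])
      fix p
      show "cnj (A p) * A p = (\<Sum>n=1..M. of_real (c n) * (cnj (A p) * chi p (a p) (int n)))"
        unfolding A_def[of p] sum_distrib_left by (simp add: mult_ac)
    qed
    also have "\<dots> = (\<Sum>n=1..M. of_real (c n) * G (int n))"
      unfolding G_def sum_distrib_left by (rule sum.swap)
    finally show ?thesis .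
  qed
  have "S = norm (complex_of_real S)" using S0 by simp
  also have "\<dots> \<le> (\<Sum>n=1..M. \<bar>c n\<bar> * norm (G (int n)))"
    unfolding S_eq by (rule sum_norm_le) (simp add: norm_mult)
  finally have "S\<^sup>2 \<le> (\<Sum>n=1..M. \<bar>c n\<bar> * norm (G (int n)))\<^sup>2"
    using S0 by (intro power_mono) auto
  also have "\<dots> \<le> (\<Sum>n=1..M. (c n)\<^sup>2) * (\<Sum>n=1..M. (norm (G (int n)))\<^sup>2)"
    using Cauchy_Schwarz_ineq_sum[of "\<lambda>n. \<bar>c n\<bar>" "\<lambda>n. norm (G (int n))" "{1..M}"] by simp
  finally have CS: "S\<^sup>2 \<le> (\<Sum>n=1..M. (c n)\<^sup>2) * (\<Sum>n=1..M. (norm (G (int n)))\<^sup>2)" .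
  \<comment> \<open>every \<open>n\<close> in \<open>{1..M}\<close> is a difference of two numbers below \<open>2 * M\<close> in at least \<open>M\<close> ways\<close>
  have "real M * (\<Sum>n=1..M. (norm (G (int n)))\<^sup>2) = (\<Sum>(n, y)\<in>{1..M} \<times> {..<M}. (norm (G (int n)))\<^sup>2)"
    by (simp add: sum_distrib_left flip: sum.cartesian_product)
  also have "\<dots> = (\<Sum>(x, y)\<in>(\<lambda>(n, y). (y + n, y)) ` ({1..M} \<times> {..<M}). (norm (G (int x - int y)))\<^sup>2)"
    by (subst sum.reindex) (auto simp: inj_on_def intro!: sum.cong)
  also have "\<dots> \<le> (\<Sum>(x, y)\<in>{..<2*M} \<times> {..<2*M}. (norm (G (int x - int y)))\<^sup>2)"
    by (rule sum_mono2) auto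
  also have "\<dots> = (\<Sum>x<2*M. \<Sum>y<2*M. (norm (G (int x - int y)))\<^sup>2)"
    by (simp flip: sum.cartesian_product)
  finally have fejer: "real M * (\<Sum>n=1..M. (norm (G (int n)))\<^sup>2)
      \<le> (\<Sum>x<2*M. \<Sum>y<2*M. (norm (G (int x - int y)))\<^sup>2)" .
  have "complex_of_real (\<Sum>x<2*M. \<Sum>y<2*M. (norm (G (int x - int y)))\<^sup>2)
      = (\<Sum>x<2*M. \<Sum>y<2*M. \<Sum>p\<in>J. \<Sum>q\<in>J. cnj (A p) * A q *
          (chi p (a p) (int x - int y) * cnj (chi q (a q) (int x - int y))))"
    unfolding of_real_sum complex_norm_square G_def cnj_sum sum_product
    by (simp add: mult_ac)
  also have "\<dots> = (\<Sum>x<2*M. \<Sum>p\<in>J. \<Sum>q\<in>J. \<Sum>y<2*M. cnj (A p) * A q *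
          (chi p (a p) (int x - int y) * cnj (chi q (a q) (int x - int y))))"
    by (rule sum.cong[OF refl], subst sum.swap, rule sum.cong[OF refl], rule sum.swap)
  also have "\<dots> = (\<Sum>p\<in>J. \<Sum>q\<in>J. \<Sum>x<2*M. \<Sum>y<2*M. cnj (A p) * A q *
          (chi p (a p) (int x - int y) * cnj (chi q (a q) (int x - int y))))"
    by (subst sum.swap, rule sum.cong[OF refl], rule sum.swap)
  also have "\<dots> = (\<Sum>p\<in>J. \<Sum>q\<in>J. cnj (A p) * A q * T p q)"
    unfolding T_def sum_distrib_left ..
  finally have G_eq: "complex_of_real (\<Sum>x<2*M. \<Sum>y<2*M. (norm (G (int x - int y)))\<^sup>2)
      = (\<Sum>p\<in>J. \<Sum>q\<in>J. cnj (A p) * A q * T p q)" .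
  have "(\<Sum>x<2*M. \<Sum>y<2*M. (norm (G (int x - int y)))\<^sup>2)
      = norm (complex_of_real (\<Sum>x<2*M. \<Sum>y<2*M. (norm (G (int x - int y)))\<^sup>2))"
    by (simp only: norm_of_real) (simp add: sum_nonneg)
  also have "\<dots> \<le> (\<Sum>p\<in>J. \<Sum>q\<in>J. norm (A p) * norm (A q) * ((if p = q then 4 * (real M)\<^sup>2 else 0) + E))"
    unfolding G_eq
  proof (intro sum_norm_le)
    fix p q assume "p \<in> J" "q \<in> J"
    thus "norm (cnj (A p) * A q * T p q)
        \<le> norm (A p) * norm (A q) * ((if p = q then 4 * (real M)\<^sup>2 else 0) + E)"
      unfolding norm_mult complex_mod_cnj by (intro mult_left_mono T_le) auto
  qed
  also have "\<dots> = (\<Sum>p\<in>J. \<Sum>q\<in>J. if p = q then norm (A p) * norm (A q) * (4 * (real M)\<^sup>2) else 0)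
      + (\<Sum>p\<in>J. \<Sum>q\<in>J. norm (A p) * norm (A q) * E)"
    unfolding sum.distrib[symmetric] by (intro sum.cong refl) (simp add: distrib_left)
  also have "\<dots> = 4 * (real M)\<^sup>2 * S + E * (\<Sum>p\<in>J. norm (A p))\<^sup>2"
    using finJ by (simp add: S_def power2_eq_square sum_product sum_distrib_left mult_ac)
  also have "(\<Sum>p\<in>J. norm (A p))\<^sup>2 \<le> real (card J) * S"
    using Cauchy_Schwarz_ineq_sum[of "\<lambda>_. 1" "\<lambda>p. norm (A p)" J] by (simp add: S_def)
  also have "real (card J) * S \<le> real P * S" using cardJ S0 by (intro mult_right_mono) auto
  finally have GG: "(\<Sum>x<2*M. \<Sum>y<2*M. (norm (G (int x - int y)))\<^sup>2)
      \<le> 4 * (real M)\<^sup>2 * S + E * (real P * S)" using E0 by (simp add: mult_left_mono)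
  \<comment> \<open>The factor \<open>P\<close> comes from \<open>card J\<close>. The loss of 4M / P
    to 4M is harmless next to the diagonal term.\<close>
  have "E * real P \<le> real M * (4 * real M + 8 * real P ^ 3)"
  proof -
    have "4 * real M / real P \<le> 4 * real M / 1" using P by (intro divide_left_mono) auto
    moreover have "E * real P = real M * (4 * real M / real P + 8 * real P ^ 3)"
      using P by (simp add: E_def power2_eq_square power3_eq_cube field_simps)
    ultimately show ?thesis by (simp add: mult_left_mono)
  qed
  hence "E * real P * S \<le> real M * (4 * real M + 8 * real P ^ 3) * S" using S0 by (rule mult_right_mono)
  hence "real M * (\<Sum>n=1..M. (norm (G (int n)))\<^sup>2) \<le> real M * ((8 * real M + 8 * real P ^ 3) * S)"
    using fejer GG by (simp add: power2_eq_square algebra_simps)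
  hence "(\<Sum>n=1..M. (norm (G (int n)))\<^sup>2) \<le> (8 * real M + 8 * real P ^ 3) * S"
    using M by simp
  hence "S\<^sup>2 \<le> (\<Sum>n=1..M. (c n)\<^sup>2) * ((8 * real M + 8 * real P ^ 3) * S)"
    using CS by (meson mult_left_mono order_trans sum_nonneg zero_le_power2)
  hence "S * S \<le> ((8 * real M + 8 * real P ^ 3) * (\<Sum>n=1..M. (c n)\<^sup>2)) * S"
    by (simp add: power2_eq_square mult_ac)
  moreover have "0 \<le> (8 * real M + 8 * real P ^ 3) * (\<Sum>n=1..M. (c n)\<^sup>2)"
    by (simp add: sum_nonneg)
  \<comment> \<open>Cancelling \<open>S\<close> needs \<open>S > 0\<close>; for \<open>S = 0\<close>
    the right-hand side is nonnegative anyway.\<close>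
  ultimately have "S \<le> (8 * real M + 8 * real P ^ 3) * (\<Sum>n=1..M. (c n)\<^sup>2)"
    using S0 by (cases "S = 0") (auto simp: mult_le_cancel_right)
  thus ?thesis by (simp add: S_def A_def)
qed

subsection \<open>The divisor bound\<close>

definition num_divisors :: "nat \<Rightarrow> nat" where
  "num_divisors n = card {d. d dvd n}"

text \<open>Each divisor splits into \<open>p ^ i\<close> with \<open>i \<le> k\<close> and a
  divisor of \<open>m\<close>.\<close>

lemma num_divisors_prime_power_mult_le:
  assumes "prime (p :: nat)" "m > 0"
  shows "num_divisors (p ^ k * m) \<le> (k + 1) * num_divisors m"
proof -
  have "{d. d dvd p ^ k * m} \<subseteq> (\<lambda>(i, e). p ^ i * e) ` ({..k} \<times> {d. d dvd m})"
  proof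
    fix d assume "d \<in> {d. d dvd p ^ k * m}"
    then obtain b e where "d = b * e" "b dvd p ^ k" "e dvd m" using division_decomp by blast
    moreover from this obtain i where "i \<le> k" "b = p ^ i"
      using divides_primepow_nat[OF assms(1)] by blast
    ultimately show "d \<in> (\<lambda>(i, e). p ^ i * e) ` ({..k} \<times> {d. d dvd m})" by force
  qed
  moreover have "finite ({..k} \<times> {d. d dvd m})" using assms(2) by simp
  ultimately have "num_divisors (p ^ k * m) \<le> card ({..k} \<times> {d. d dvd m})"
    unfolding num_divisors_def by (rule surj_card_le[rotated])
  thus ?thesis by (simp add: num_divisors_def card_cartesian_product)
qed

text \<open>Prime powers are split off one at a time. For \<open>p \<ge> K\<close> the factor k + 1
  is paid for by the power of p itself; each smaller prime costs a factor \<open>B\<close>, and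
  there are at most \<open>K\<close> of these.\<close>

lemma num_divisors_le_powr:
  assumes "\<delta> > 0"
  shows "\<exists>C\<ge>1. \<forall>n\<ge>1. real (num_divisors n) \<le> C * real n powr \<delta>"
proof -
  \<comment> \<open>Chosen so that k + 1 is at most B (1 + k \<delta> ln 2), to which the inequality
    1 + x \<le> exp x applies.\<close>
  define B where "B = 1 + 1 / (\<delta> * ln 2)"
  have B: "B \<ge> 1" using assms by (simp add: B_def)
  have Suc_le: "real (k + 1) \<le> B * (2 powr \<delta>) ^ k" for k
  proof -
    have "real (k + 1) \<le> B * (1 + real k * \<delta> * ln 2)"
      using assms by (simp add: B_def field_simps)
    also have "1 + real k * \<delta> * ln 2 \<le> exp (real k * \<delta> * ln 2)" by (rule exp_ge_add_one_self)
    also have "\<dots> = (2 powr \<delta>) ^ k" by (simp add: powr_def exp_of_nat_mult mult_ac flip: exp_of_nat_mult)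
    finally show ?thesis using B by simp
  qed
  \<comment> \<open>The threshold from which \<open>real p powr \<delta>\<close> is at least
    2.\<close>
  define K where "K = nat \<lceil>2 powr (1 / \<delta>)\<rceil>"
  have K: "real p powr \<delta> \<ge> 2" if "p \<ge> K" for p
  proof -
    have "2 powr (1 / \<delta>) \<le> real p" using that by (simp add: K_def nat_le_iff ceiling_le_iff)
    hence "(2 powr (1 / \<delta>)) powr \<delta> \<le> real p powr \<delta>" using assms by (intro powr_mono2) auto
    thus ?thesis using assms by (simp add: powr_powr)
  qed
  define s where "s n = {p. prime p \<and> p dvd n \<and> p < K}" for n
  have fin: "finite (s n)" for n by (simp add: s_def)
  have main: "real (num_divisors n) \<le> B ^ card (s n) * real n powr \<delta>" if "n \<ge> 1" for n
    using that
  proof (induction n rule: less_induct)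
    case (less n)
    show ?case
    proof (cases "n = 1")
      case True
      thus ?thesis using B by (simp add: num_divisors_def)
    next
      case False
      then obtain p where p: "prime p" "p dvd n" using prime_factor_nat by blast
      have p1: "p > 1" using p(1) prime_gt_1_nat by blast
      obtain k m where km: "\<not> p dvd m" "n = m * p ^ k"
        using prime_power_canonical[OF p(1), of n] less.prems by auto
      have m1: "m \<ge> 1" using km less.prems by (cases "m = 0") auto
      have "k \<noteq> 0" using km p(2) by (cases k) auto
      hence "1 < p ^ k" using p1 one_less_power[of p k] by simp
      hence "m < n" using m1 km(2) by simp
      have IH: "real (num_divisors m) \<le> B ^ card (s m) * real m powr \<delta>"
        using less.IH[OF \<open>m < n\<close> m1] .
      have n_powr: "real n powr \<delta> = (real p powr \<delta>) ^ k * real m powr \<delta>"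
        using p1 by (simp add: km(2) powr_mult powr_power powr_powr powr_realpow[symmetric] mult_ac)
      have step: "real (k + 1) * B ^ card (s m) \<le> B ^ card (s n) * (real p powr \<delta>) ^ k"
      proof (cases "p < K")
        case True
        have "insert p (s m) \<subseteq> s n" using True p km by (auto simp: s_def)
        moreover have "p \<notin> s m" using km(1) by (simp add: s_def)
        ultimately have "card (s m) + 1 \<le> card (s n)"
          using card_mono[OF fin, of "insert p (s m)" n] fin[of m] by simp
        hence "B ^ (card (s m) + 1) \<le> B ^ card (s n)" using B by (intro power_increasing) auto
        moreover have "(2 powr \<delta>) ^ k \<le> (real p powr \<delta>) ^ k"
          using p1 assms by (intro power_mono powr_mono2) auto
        ultimately have "B ^ (card (s m) + 1) * (2 powr \<delta>) ^ k
            \<le> B ^ card (s n) * (real p powr \<delta>) ^ k"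
          using B by (intro mult_mono) auto
        moreover have "real (k + 1) * B ^ card (s m) \<le> (B * (2 powr \<delta>) ^ k) * B ^ card (s m)"
          using Suc_le B by (intro mult_right_mono) auto
        ultimately show ?thesis by (simp add: mult_ac)
      next
        case False
        have "card (s m) \<le> card (s n)" using km by (intro card_mono fin) (auto simp: s_def)
        hence 1: "B ^ card (s m) \<le> B ^ card (s n)" using B by (intro power_increasing) auto
        have "k + 1 \<le> 2 ^ k" by (induction k) auto
        hence "real (k + 1) \<le> 2 ^ k" by (metis of_nat_le_iff of_nat_numeral of_nat_power)
        also have "\<dots> \<le> (real p powr \<delta>) ^ k" using K False by (intro power_mono) auto
        finally have "real (k + 1) * B ^ card (s m) \<le> (real p powr \<delta>) ^ k * B ^ card (s n)"
          using 1 B by (intro mult_mono) auto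
        thus ?thesis by (simp add: mult_ac)
      qed
      have "real (num_divisors n) \<le> real ((k + 1) * num_divisors m)"
        using num_divisors_prime_power_mult_le[OF p(1), of m k] m1 km(2)
        by (simp add: mult.commute del: of_nat_mult)
      also have "\<dots> = real (k + 1) * real (num_divisors m)" by (rule of_nat_mult)
      also have "\<dots> \<le> real (k + 1) * (B ^ card (s m) * real m powr \<delta>)"
        using IH by (intro mult_left_mono) auto
      also have "\<dots> = real (k + 1) * B ^ card (s m) * real m powr \<delta>" by (simp only: mult.assoc)
      also have "\<dots> \<le> B ^ card (s n) * (real p powr \<delta>) ^ k * real m powr \<delta>"
        using step by (intro mult_right_mono) auto
      finally show ?thesis by (simp add: n_powr mult_ac)
    qed
  qed
  have "real (num_divisors n) \<le> B ^ K * real n powr \<delta>" if "n \<ge> 1" for n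
  proof -
    have "card (s n) \<le> card {..<K}" by (intro card_mono) (auto simp: s_def)
    hence "B ^ card (s n) \<le> B ^ K" using B by (intro power_increasing) auto
    thus ?thesis using main[OF that] by (meson mult_right_mono order_trans powr_ge_zero)
  qed
  thus ?thesis using B by (intro exI[of _ "B ^ K"]) auto
qed

text \<open>The maximum makes the bound monotone for \<open>x \<ge> 1\<close>, so one value serves
  all products and all blocks.\<close>

definition max_num_divisors :: "nat \<Rightarrow> nat" where
  "max_num_divisors x = Max (num_divisors ` {1..x})"

lemma num_divisors_le_max: "n \<in> {1..x} \<Longrightarrow> num_divisors n \<le> max_num_divisors x"
  unfolding max_num_divisors_def by (intro Max_ge) auto

lemma max_num_divisors_ge_1: "x \<ge> 1 \<Longrightarrow> max_num_divisors x \<ge> 1"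
  using num_divisors_le_max[of 1 x] by (simp add: num_divisors_def)

lemma max_num_divisors_le_powr:
  assumes "\<delta> > 0"
  shows "\<exists>C\<ge>1. \<forall>x\<ge>1. real (max_num_divisors x) \<le> C * real x powr \<delta>"
proof -
  obtain C where C: "C \<ge> 1" "\<And>n. n \<ge> 1 \<Longrightarrow> real (num_divisors n) \<le> C * real n powr \<delta>"
    using num_divisors_le_powr[OF assms] by blast
  have "real (max_num_divisors x) \<le> C * real x powr \<delta>" if "x \<ge> 1" for x
  proof -
    have "max_num_divisors x \<in> num_divisors ` {1..x}"
      unfolding max_num_divisors_def using that by (intro Max_in) auto
    then obtain n where n: "n \<in> {1..x}" "max_num_divisors x = num_divisors n" by blast
    have "real (num_divisors n) \<le> C * real n powr \<delta>" using C(2) n by simp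
    also have "\<dots> \<le> C * real x powr \<delta>" using n C(1) assms by (intro mult_left_mono powr_mono2) auto
    finally show ?thesis using n by simp
  qed
  thus ?thesis using C(1) by blast
qed

text \<open>The k + 1 powers of two up to \<open>2 ^ k\<close> all divide it. This lets the divisor
  bound pay for the number of dyadic scales.\<close>

lemma le_max_num_divisors_power_two:
  assumes "2 ^ k \<le> x"
  shows "k \<le> max_num_divisors x"
proof -
  have "card ((^) (2::nat) ` {..k}) \<le> num_divisors (2 ^ k)"
    unfolding num_divisors_def by (intro card_mono) (auto intro: le_imp_power_dvd)
  moreover have "card ((^) (2::nat) ` {..k}) = k + 1" by (simp add: card_image inj_on_def)
  moreover have "num_divisors (2 ^ k) \<le> max_num_divisors x"
    using assms by (intro num_divisors_le_max) auto
  ultimately show ?thesis by linarith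
qed

subsection \<open>Moments of character sums\<close>

lemma chi_prod:
  assumes "prime p"
  shows "chi p a (\<Prod>i\<in>A. f i) = (\<Prod>i\<in>A. chi p a (f i))"
  by (induction A rule: infinite_finite_induct) (simp_all add: chi_1[OF assms] chi_mult[OF assms])

text \<open>By multiplicativity the power of the sum is a sum over n with coefficient
  \<open>c n\<close>, the number of \<open>\<nu>\<close>-tuples from \<open>I\<close> with product
  n. The sum of squares of \<open>c\<close> is at most its maximum times its total, and the total
  keeps \<open>card I\<close> instead of \<open>X\<close>.\<close>

lemma moment_chi_le:
  assumes P: "P \<ge> 1" and X: "X \<ge> 1" and I: "I \<subseteq> {1..X}"
    and J: "J \<subseteq> {p. prime p \<and> P < p \<and> p \<le> 2 * P}" and a: "\<And>p. p \<in> J \<Longrightarrow> coprime (a p) (int p)"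
  shows "(\<Sum>p\<in>J. norm (\<Sum>n\<in>I. chi p (a p) (int n)) ^ (2 * \<nu>))
    \<le> (8 * real X ^ \<nu> + 8 * real P ^ 3) * (real (max_num_divisors (X ^ \<nu>)) ^ \<nu> * real (card I) ^ \<nu>)"
proof -
  have finI: "finite I" using I finite_subset by blast
  define M where "M = X ^ \<nu>"
  define D where "D = max_num_divisors M"
  define S where "S = PiE {..<\<nu>} (\<lambda>_. I)"
  have finS: "finite S" unfolding S_def using finI by (intro finite_PiE) auto
  define c where "c n = card {f \<in> S. (\<Prod>i<\<nu>. f i) = n}" for n
  have prod_in: "(\<lambda>f. \<Prod>i<\<nu>. f i) ` S \<subseteq> {1..M}"
  proof
    fix n assume "n \<in> (\<lambda>f. \<Prod>i<\<nu>. f i) ` S"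
    then obtain f where f: "f \<in> S" "n = (\<Prod>i<\<nu>. f i)" by blast
    have fi: "f i \<in> {1..X}" if "i < \<nu>" for i using f that I by (auto simp: S_def PiE_def Pi_def)
    have "(\<Prod>i<\<nu>. f i) \<le> (\<Prod>i<\<nu>. X)" using fi by (intro prod_mono) auto
    moreover have "(\<Prod>i<\<nu>. f i) \<ge> (\<Prod>i<\<nu>. 1)" using fi by (intro prod_mono) auto
    ultimately show "n \<in> {1..M}" using f by (simp add: M_def)
  qed
  \<comment> \<open>Each of the \<open>\<nu>\<close> entries of such a tuple divides
    \<open>n\<close>.\<close>
  have c_le: "c n \<le> D ^ \<nu>" if "n \<in> {1..M}" for n
  proof -
    have "{f \<in> S. (\<Prod>i<\<nu>. f i) = n} \<subseteq> PiE {..<\<nu>} (\<lambda>_. {d. d dvd n})"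
      by (auto simp: S_def PiE_def Pi_def intro!: dvd_prodI)
    moreover have "finite (PiE {..<\<nu>} (\<lambda>_. {d. d dvd n}))" using that by (intro finite_PiE) auto
    ultimately have "c n \<le> card (PiE {..<\<nu>} (\<lambda>_. {d. d dvd n}))" unfolding c_def by (rule card_mono[rotated])
    also have "\<dots> = num_divisors n ^ \<nu>" by (simp add: card_PiE num_divisors_def)
    also have "\<dots> \<le> D ^ \<nu>" unfolding D_def using num_divisors_le_max[OF that] by (rule power_mono) simp
    finally show ?thesis .
  qed
  have "(\<Sum>n\<in>{1..M}. c n) = card S"
    using sum.group[OF finS _ prod_in, of "\<lambda>_. 1 :: nat"] by (simp add: c_def)
  hence sum_c: "(\<Sum>n\<in>{1..M}. real (c n)) = real (card I) ^ \<nu>"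
    by (simp add: S_def card_PiE flip: of_nat_sum)
  have "(\<Sum>n=1..M. (real (c n))\<^sup>2) \<le> (\<Sum>n=1..M. real D ^ \<nu> * real (c n))"
  proof (rule sum_mono)
    fix n assume "n \<in> {1..M}"
    hence "real (c n) \<le> real D ^ \<nu>" using c_le by (metis of_nat_le_iff of_nat_power)
    thus "(real (c n))\<^sup>2 \<le> real D ^ \<nu> * real (c n)" by (simp add: power2_eq_square mult_right_mono)
  qed
  also have "\<dots> = real D ^ \<nu> * real (card I) ^ \<nu>" by (simp only: sum_c sum_distrib_left[symmetric])
  finally have sum_c2: "(\<Sum>n=1..M. (real (c n))\<^sup>2) \<le> real D ^ \<nu> * real (card I) ^ \<nu>" .
  have pow: "(\<Sum>n\<in>I. chi p (a p) (int n)) ^ \<nu> = (\<Sum>n=1..M. of_real (real (c n)) * chi p (a p) (int n))"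
    if "p \<in> J" for p
  proof -
    have p: "prime p" using that J by auto
    have "(\<Sum>n\<in>I. chi p (a p) (int n)) ^ \<nu> = (\<Prod>i<\<nu>. \<Sum>n\<in>I. chi p (a p) (int n))" by simp
    also have "\<dots> = (\<Sum>f\<in>S. \<Prod>i<\<nu>. chi p (a p) (int (f i)))"
      unfolding S_def using finI by (intro prod_sum_PiE) auto
    also have "\<dots> = (\<Sum>f\<in>S. chi p (a p) (int (\<Prod>i<\<nu>. f i)))"
      by (simp add: chi_prod[OF p])
    also have "\<dots> = (\<Sum>n\<in>{1..M}. \<Sum>f\<in>{f \<in> S. (\<Prod>i<\<nu>. f i) = n}. chi p (a p) (int (\<Prod>i<\<nu>. f i)))"
      by (rule sum.group[OF finS _ prod_in, symmetric]) simp
    also have "\<dots> = (\<Sum>n\<in>{1..M}. of_real (real (c n)) * chi p (a p) (int n))"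
    proof (rule sum.cong[OF refl])
      fix n
      have "(\<Sum>f\<in>{f \<in> S. (\<Prod>i<\<nu>. f i) = n}. chi p (a p) (int (\<Prod>i<\<nu>. f i)))
          = (\<Sum>f\<in>{f \<in> S. (\<Prod>i<\<nu>. f i) = n}. chi p (a p) (int n))"
        by (rule sum.cong) auto
      thus "(\<Sum>f\<in>{f \<in> S. (\<Prod>i<\<nu>. f i) = n}. chi p (a p) (int (\<Prod>i<\<nu>. f i)))
          = of_real (real (c n)) * chi p (a p) (int n)" by (simp add: c_def)
    qed
    finally show ?thesis .
  qed
  have "(\<Sum>p\<in>J. norm (\<Sum>n\<in>I. chi p (a p) (int n)) ^ (2 * \<nu>))
      = (\<Sum>p\<in>J. (norm (\<Sum>n=1..M. of_real (real (c n)) * chi p (a p) (int n)))\<^sup>2)"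
    by (intro sum.cong refl) (simp only: pow[symmetric] norm_power power_mult[symmetric] mult.commute)
  also have "\<dots> \<le> (8 * real M + 8 * real P ^ 3) * (\<Sum>n=1..M. (real (c n))\<^sup>2)"
    using X by (intro large_sieve_chi P J a) (auto simp: M_def)
  also have "\<dots> \<le> (8 * real M + 8 * real P ^ 3) * (real D ^ \<nu> * real (card I) ^ \<nu>)"
    using sum_c2 by (intro mult_left_mono) auto
  finally show ?thesis by (simp add: M_def D_def)
qed

section \<open>Dyadic decomposition, for sums whose length depends on p\<close>

lemma power_sum_le:
  fixes x :: "'a \<Rightarrow> real"
  assumes "finite A" "\<And>j. j \<in> A \<Longrightarrow> x j \<ge> 0" "r \<ge> 1"
  shows "(\<Sum>j\<in>A. x j) ^ r \<le> real (card A) ^ r * (\<Sum>j\<in>A. x j ^ r)"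
proof (cases "A = {}")
  case True
  thus ?thesis using assms(3) by (simp add: power_0_left)
next
  case False
  \<comment> \<open>Comparison with the largest term loses one factor \<open>card A\<close> against
    Hoelder, which is only logarithmic in the application.\<close>
  obtain i where i: "i \<in> A" "\<And>j. j \<in> A \<Longrightarrow> x j \<le> x i"
  proof -
    have "Max (x ` A) \<in> x ` A" using assms(1) False by (intro Max_in) auto
    then obtain i where "i \<in> A" "x i = Max (x ` A)" by auto
    thus thesis using that[of i] assms(1) by simp
  qed
  have "(\<Sum>j\<in>A. x j) \<le> real (card A) * x i" using i(2) by (intro sum_bounded_above) auto
  hence "(\<Sum>j\<in>A. x j) ^ r \<le> (real (card A) * x i) ^ r"
    using assms(2) by (intro power_mono sum_nonneg) auto
  also have "\<dots> = real (card A) ^ r * x i ^ r" by (rule power_mult_distrib)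
  also have "x i ^ r \<le> (\<Sum>j\<in>A. x j ^ r)"
    using assms i(1) by (intro member_le_sum) auto
  finally show ?thesis by (simp add: mult_left_mono)
qed

text \<open>Clearing the binary digits of \<open>n\<close> one by one telescopes the sum into at
  most one block per scale. Summing over all blocks removes the dependence on
  \<open>n\<close>.\<close>

lemma prefix_sum_power_le_dyadic:
  fixes g :: "nat \<Rightarrow> complex"
  assumes n: "n < 2 ^ k" and r: "r \<ge> 1"
  shows "norm (\<Sum>i<n. g i) ^ r
    \<le> real k ^ r * (\<Sum>j<k. \<Sum>m<2 ^ (k - j). norm (\<Sum>i\<in>{m * 2 ^ j..<(m + 1) * 2 ^ j}. g i) ^ r)"
proof -
  define F where "F x = (\<Sum>i<x. g i)" for x
  \<comment> \<open>\<open>u j\<close> is \<open>n\<close> with its lowest \<open>j\<close> binary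
    digits cleared.\<close>
  define u where "u j = n div 2 ^ j * 2 ^ j" for j :: nat
  define b where "b j m = (\<Sum>i\<in>{m * 2 ^ j..<(m + 1) * 2 ^ j}. g i)" for j m :: nat
  have F_diff: "F y - F x = (\<Sum>i\<in>{x..<y}. g i)" if "x \<le> y" for x y
    using that unfolding F_def lessThan_atLeast0 by (subst sum_diff_nat_ivl) auto
  have "F (u 0) - F (u k) = (\<Sum>j<k. F (u j) - F (u (Suc j)))"
    by (rule sum_lessThan_telescope'[symmetric])
  moreover have "u 0 = n" "u k = 0" using n by (simp_all add: u_def)
  ultimately have F_eq: "F n = (\<Sum>j<k. F (u j) - F (u (Suc j)))" by (simp add: F_def)
  have diff_le: "norm (F (u j) - F (u (Suc j))) ^ r \<le> (\<Sum>m<2 ^ (k - j). norm (b j m) ^ r)" if "j < k" for j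
  proof -
    define m where "m = n div 2 ^ j"
    have "m < 2 ^ (k - j)"
      unfolding m_def using n that by (simp add: less_mult_imp_div_less flip: power_add)
    have uS: "u (Suc j) = m div 2 * 2 * 2 ^ j"
      by (simp add: u_def m_def div_mult2_eq[symmetric] mult.commute)
    show ?thesis
    \<comment> \<open>The parity of \<open>m\<close> is the digit number \<open>j\<close> of
      \<open>n\<close>. If it is 0, nothing is cleared; if it is 1, exactly the block with index
      \<open>m - 1\<close> is removed.\<close>
    proof (cases "even m")
      case True
      hence "u (Suc j) = u j" unfolding uS by (simp add: u_def m_def)
      thus ?thesis using r by (simp add: sum_nonneg power_0_left)
    next
      case False
      then obtain t where t: "m = 2 * t + 1" by (auto elim: oddE)
      have "u (Suc j) = 2 * t * 2 ^ j" "u j = (2 * t + 1) * 2 ^ j"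
        unfolding uS by (simp_all add: t u_def flip: m_def)
      hence "F (u j) - F (u (Suc j)) = b j (2 * t)" by (simp add: F_diff b_def)
      moreover have "2 * t < 2 ^ (k - j)" using \<open>m < 2 ^ (k - j)\<close> t by simp
      ultimately show ?thesis by (auto intro!: member_le_sum)
    qed
  qed
  have "norm (F n) \<le> (\<Sum>j<k. norm (F (u j) - F (u (Suc j))))" unfolding F_eq by (rule norm_sum)
  hence "norm (F n) ^ r \<le> (\<Sum>j<k. norm (F (u j) - F (u (Suc j)))) ^ r" by (rule power_mono) simp
  also have "\<dots> \<le> real (card {..<k}) ^ r * (\<Sum>j<k. norm (F (u j) - F (u (Suc j))) ^ r)"
    using r by (intro power_sum_le) auto
  also have "\<dots> \<le> real k ^ r * (\<Sum>j<k. \<Sum>m<2 ^ (k - j). norm (b j m) ^ r)"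
    using diff_le by (auto intro!: mult_left_mono sum_mono)
  finally show ?thesis by (simp add: F_def b_def)
qed

text \<open>The exponent of \<open>k\<close> is \<open>2 * \<nu>\<close> from the decomposition plus
  1 for the sum over scales.\<close>

lemma moment_chi_prefix_le:
  assumes P: "P \<ge> 1" and \<nu>: "\<nu> \<ge> 1" and L: "\<And>p. p \<in> J \<Longrightarrow> L p < 2 ^ k"
    and J: "J \<subseteq> {p. prime p \<and> P < p \<and> p \<le> 2 * P}" and a: "\<And>p. p \<in> J \<Longrightarrow> coprime (a p) (int p)"
  defines "D \<equiv> max_num_divisors ((2 ^ k) ^ \<nu>)"
  shows "(\<Sum>p\<in>J. norm (\<Sum>n<L p. chi p (a p) (int n + 1)) ^ (2 * \<nu>))
    \<le> real k ^ (2 * \<nu> + 1) * real D ^ \<nu> * (8 * (2 ^ k) ^ \<nu> + 8 * real P ^ 3) * (2 ^ k) ^ \<nu>"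
proof -
  define E where "E = (8 * (2 ^ k) ^ \<nu> + 8 * real P ^ 3) * real D ^ \<nu>"
  have E0: "E \<ge> 0" by (simp add: E_def)
  define b where "b p j m = norm (\<Sum>i\<in>{m * 2 ^ j..<(m + 1) * 2 ^ j}. chi p (a p) (int i + 1)) ^ (2 * \<nu>)"
    for p j m :: nat
  have block: "(\<Sum>p\<in>J. b p j m) \<le> E * (2 ^ j) ^ \<nu>" if "j < k" "m < 2 ^ (k - j)" for j m
  proof -
    define I where "I = {m * 2 ^ j + 1..(m + 1) * 2 ^ j}"
    have "(m + 1) * 2 ^ j \<le> 2 ^ (k - j) * 2 ^ j" using that by (intro mult_right_mono) auto
    also have "\<dots> = (2 ^ k :: nat)" using that by (simp flip: power_add)
    finally have "I \<subseteq> {1..2 ^ k}" by (auto simp: I_def)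
    hence "(\<Sum>p\<in>J. norm (\<Sum>n\<in>I. chi p (a p) (int n)) ^ (2 * \<nu>))
        \<le> (8 * real (2 ^ k) ^ \<nu> + 8 * real P ^ 3) * (real D ^ \<nu> * real (card I) ^ \<nu>)"
      unfolding D_def by (intro moment_chi_le P J a) auto
    moreover have "(\<Sum>n\<in>I. chi p (a p) (int n)) = (\<Sum>i\<in>{m * 2 ^ j..<(m + 1) * 2 ^ j}. chi p (a p) (int i + 1))" for p
      unfolding I_def by (rule sum.reindex_bij_witness[of _ "\<lambda>i. i + 1" "\<lambda>n. n - 1"]) auto
    moreover have "card I = 2 ^ j" by (simp add: I_def)
    ultimately show ?thesis by (simp add: b_def E_def mult.assoc)
  qed
  have "(\<Sum>p\<in>J. norm (\<Sum>n<L p. chi p (a p) (int n + 1)) ^ (2 * \<nu>))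
      \<le> (\<Sum>p\<in>J. real k ^ (2 * \<nu>) * (\<Sum>j<k. \<Sum>m<2 ^ (k - j). b p j m))"
    unfolding b_def using L \<nu> by (intro sum_mono prefix_sum_power_le_dyadic) auto
  also have "\<dots> = real k ^ (2 * \<nu>) * (\<Sum>j<k. \<Sum>m<2 ^ (k - j). \<Sum>p\<in>J. b p j m)"
    unfolding sum_distrib_left[symmetric]
    by (subst sum.swap, rule arg_cong[of _ _ "\<lambda>x. _ * x"], rule sum.cong[OF refl], rule sum.swap)
  also have "\<dots> \<le> real k ^ (2 * \<nu>) * (\<Sum>j<k. E * (2 ^ k) ^ \<nu>)"
  proof (intro mult_left_mono sum_mono)
    fix j assume j: "j \<in> {..<k}"
    have "(\<Sum>m<2 ^ (k - j). \<Sum>p\<in>J. b p j m) \<le> (\<Sum>m<2 ^ (k - j) :: nat. E * (2 ^ j) ^ \<nu>)"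
      using block j by (intro sum_mono) auto
    also have "\<dots> = E * (2 ^ (k - j) * (2 ^ j) ^ \<nu>)" by simp
    \<comment> \<open>One factor \<open>2 ^ j\<close>, available since \<open>\<nu> \<ge> 1\<close>,
      pays for the number \<open>2 ^ (k - j)\<close> of blocks.\<close>
    also have "(2 ^ j :: real) ^ \<nu> = 2 ^ j * (2 ^ j) ^ (\<nu> - 1)"
      using \<nu> by (cases \<nu>) auto
    also have "2 ^ (k - j) * (2 ^ j * (2 ^ j) ^ (\<nu> - 1)) = (2 ^ k :: real) * (2 ^ j) ^ (\<nu> - 1)"
      using j by (simp flip: power_add mult.assoc)
    also have "\<dots> \<le> 2 ^ k * (2 ^ k) ^ (\<nu> - 1)"
      using j by (intro mult_left_mono power_mono power_increasing) auto
    also have "\<dots> = (2 ^ k :: real) ^ \<nu>" using \<nu> by (cases \<nu>) auto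
    finally show "(\<Sum>m<2 ^ (k - j). \<Sum>p\<in>J. b p j m) \<le> E * (2 ^ k) ^ \<nu>"
      using E0 by (simp add: mult_left_mono)
  qed simp
  finally show ?thesis by (simp add: E_def mult_ac)
qed

section \<open>Absorbing the losses into a factor P^o(1)\<close>

lemma max_num_divisors_subpolynomial:
  fixes K \<delta> :: real and \<nu> r :: nat
  assumes "\<delta> > 0" "K \<ge> 1" "\<nu> \<ge> 1" "r \<ge> 1"
  shows "\<forall>\<^sub>F P in sequentially. K * real (max_num_divisors ((4 * P\<^sup>2) ^ \<nu>)) ^ r \<le> real P powr \<delta>"
proof -
  \<comment> \<open>With this exponent the divisor bound costs the power \<delta> / 2 of
    \<open>P\<close>; the other half absorbs the constant \<open>B\<close>.\<close>
  define \<eta> where "\<eta> = \<delta> / (4 * real \<nu> * real r)"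
  have \<eta>: "\<eta> > 0" using assms by (simp add: \<eta>_def)
  obtain C where C: "C \<ge> 1" "\<And>x. x \<ge> 1 \<Longrightarrow> real (max_num_divisors x) \<le> C * real x powr \<eta>"
    using max_num_divisors_le_powr[OF \<eta>] by blast
  define B where "B = K * C ^ r * 4 powr (\<delta> / 4)"
  have B: "B > 0" using C assms by (simp add: B_def)
  have "K * real (max_num_divisors ((4 * P\<^sup>2) ^ \<nu>)) ^ r \<le> real P powr \<delta>"
    if P: "P \<ge> max 1 (nat \<lceil>B powr (2 / \<delta>)\<rceil>)" for P
  proof -
    have P1: "P \<ge> 1" and "B powr (2 / \<delta>) \<le> real P"
      using P by (auto simp: nat_le_iff ceiling_le_iff)
    hence "(B powr (2 / \<delta>)) powr (\<delta> / 2) \<le> real P powr (\<delta> / 2)"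
      using assms by (intro powr_mono2) auto
    hence B_le: "B \<le> real P powr (\<delta> / 2)" using assms B by (simp add: powr_powr)
    have "real (max_num_divisors ((4 * P\<^sup>2) ^ \<nu>)) \<le> C * real ((4 * P\<^sup>2) ^ \<nu>) powr \<eta>"
      using P1 by (intro C(2)) simp
    hence "real (max_num_divisors ((4 * P\<^sup>2) ^ \<nu>)) ^ r \<le> (C * real ((4 * P\<^sup>2) ^ \<nu>) powr \<eta>) ^ r"
      by (rule power_mono) simp
    also have "\<dots> = C ^ r * (real ((4 * P\<^sup>2) ^ \<nu>) powr \<eta>) powr real r"
      using P1 by (simp add: power_mult_distrib powr_realpow)
    also have "real ((4 * P\<^sup>2) ^ \<nu>) = (4 * real P powr 2) powr real \<nu>"
      using P1 by (simp add: powr_realpow)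
    also have "(((4 * real P powr 2) powr real \<nu>) powr \<eta>) powr real r
        = (4 * real P powr 2) powr (real \<nu> * \<eta> * real r)"
      by (simp only: powr_powr)
    also have "real \<nu> * \<eta> * real r = \<delta> / 4" using assms by (simp add: \<eta>_def)
    also have "(4 * real P powr 2) powr (\<delta> / 4) = 4 powr (\<delta> / 4) * real P powr (\<delta> / 2)"
      by (subst powr_mult) (simp_all add: powr_powr del: powr_numeral)
    finally have "K * real (max_num_divisors ((4 * P\<^sup>2) ^ \<nu>)) ^ r
        \<le> K * (C ^ r * (4 powr (\<delta> / 4) * real P powr (\<delta> / 2)))"
      using assms by (intro mult_left_mono) auto
    also have "\<dots> = B * real P powr (\<delta> / 2)" by (simp add: B_def)
    also have "\<dots> \<le> real P powr (\<delta> / 2) * real P powr (\<delta> / 2)"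
      using B_le by (intro mult_right_mono) auto
    also have "\<dots> = real P powr \<delta>" by (simp flip: powr_add)
    finally show ?thesis .
  qed
  thus ?thesis unfolding eventually_sequentially by blast
qed

theorem theorem8:
  fixes \<nu> :: nat
  assumes "\<nu> \<ge> 1"
  shows "\<exists>\<epsilon> :: nat \<Rightarrow> real. \<epsilon> \<longlonglongrightarrow> 0 \<and>
    (\<exists>P0 N0 :: nat. \<forall>(P :: nat) (N :: nat) (Np :: nat \<Rightarrow> nat).
       P \<ge> 1 \<longrightarrow> P \<ge> P0 \<longrightarrow> N \<ge> 1 \<longrightarrow> N \<ge> N0 \<longrightarrow> N \<le> P ^ 2 \<longrightarrow>
       (\<forall>p. prime p \<longrightarrow> P < p \<longrightarrow> p \<le> 2 * P \<longrightarrow> N < Np p \<and> Np p \<le> 2 * N) \<longrightarrow>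
       (\<Sum>p | prime p \<and> P < p \<and> p \<le> 2 * P.
          Max ((\<lambda>a. norm (fermat_sum p a (Np p)) ^ (2 * \<nu>)) ` {a :: int. coprime a (int p)}))
       \<le> (real P ^ 3 + real N ^ \<nu>
            + min (real N ^ \<nu> * real P powr (1 / 2)) (real N powr (real \<nu> / 2) * real P ^ 2))
          * real N ^ \<nu> * real P powr \<epsilon> P)"
proof -
  \<comment> \<open>The 8 comes from the large sieve, and 16 = 4 * 4 because
    \<open>2 ^ k \<le> 4 * N\<close> is used in two factors. Below, \<open>r\<close> is the sum of
    2\<nu> + 1 for \<open>k\<close> and \<nu> for the coefficients.\<close>
  define K :: real where "K = 8 * 16 ^ \<nu>"
  define r where "r = 3 * \<nu> + 1"
  define D where "D P = max_num_divisors ((4 * P\<^sup>2) ^ \<nu>)" for P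
  \<comment> \<open>Then \<open>real P powr \<epsilon> P\<close> is exactly the total loss. It
    depends on \<open>P\<close> alone, which gives uniformity in \<open>N\<close> and
    \<open>Np\<close>.\<close>
  define \<epsilon> where "\<epsilon> P = log (real P) (K * real (D P) ^ r)" for P
  have "(16 :: real) ^ \<nu> \<ge> 1" by (rule one_le_power) simp
  hence K1: "K \<ge> 1" unfolding K_def by linarith
  have D1: "D P \<ge> 1" if "P \<ge> 1" for P
    unfolding D_def using that by (intro max_num_divisors_ge_1) simp
  have KD1: "K * real (D P) ^ r \<ge> 1" if "P \<ge> 1" for P
    using K1 D1[OF that] mult_mono[of 1 K 1 "real (D P) ^ r"] by simp
  have "\<epsilon> \<longlonglongrightarrow> 0"
  proof (rule tendstoI)
    fix \<delta> :: real assume \<delta>: "\<delta> > 0"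
    have "\<forall>\<^sub>F P in sequentially. K * real (D P) ^ r \<le> real P powr (\<delta> / 2)"
      unfolding D_def using \<delta> K1 assms by (intro max_num_divisors_subpolynomial) (auto simp: r_def)
    moreover have "\<forall>\<^sub>F P in sequentially. P \<ge> (2 :: nat)" by (rule eventually_ge_at_top)
    ultimately show "\<forall>\<^sub>F P in sequentially. dist (\<epsilon> P) 0 < \<delta>"
    proof eventually_elim
      case (elim P)
      have "\<epsilon> P \<le> \<delta> / 2"
        unfolding \<epsilon>_def using elim KD1[of P] by (subst log_le_iff) auto
      moreover have "\<epsilon> P \<ge> 0" unfolding \<epsilon>_def using elim KD1[of P] by (subst zero_le_log_cancel_iff) auto
      ultimately show ?case using \<delta> by simp
    qed
  qed
  moreover have "(\<Sum>p | prime p \<and> P < p \<and> p \<le> 2 * P.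
          Max ((\<lambda>a. norm (fermat_sum p a (Np p)) ^ (2 * \<nu>)) ` {a :: int. coprime a (int p)}))
       \<le> (real P ^ 3 + real N ^ \<nu>
            + min (real N ^ \<nu> * real P powr (1 / 2)) (real N powr (real \<nu> / 2) * real P ^ 2))
          * real N ^ \<nu> * real P powr \<epsilon> P"
    if P: "P \<ge> 2" and N: "N \<ge> 1" "N \<le> P\<^sup>2"
      and Np: "\<forall>p. prime p \<longrightarrow> P < p \<longrightarrow> p \<le> 2 * P \<longrightarrow> N < Np p \<and> Np p \<le> 2 * N"
    for P N :: nat and Np :: "nat \<Rightarrow> nat"
  proof -
    define J where "J = {p. prime p \<and> P < p \<and> p \<le> 2 * P}"
    have "\<forall>p\<in>J. \<exists>a. coprime a (int p) \<and>
        Max ((\<lambda>a. norm (fermat_sum p a (Np p)) ^ (2 * \<nu>)) ` {a :: int. coprime a (int p)})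
        = norm (fermat_sum p a (Np p)) ^ (2 * \<nu>)"
    proof
      fix p assume "p \<in> J"
      hence "p > 0" by (simp add: J_def)
      from Max_in[OF fermat_sum_max_wf[OF this]]
      show "\<exists>a. coprime a (int p) \<and>
        Max ((\<lambda>a. norm (fermat_sum p a (Np p)) ^ (2 * \<nu>)) ` {a :: int. coprime a (int p)})
        = norm (fermat_sum p a (Np p)) ^ (2 * \<nu>)" by blast
    qed
    from bchoice[OF this] obtain a where a: "\<And>p. p \<in> J \<Longrightarrow> coprime (a p) (int p)"
      "\<And>p. p \<in> J \<Longrightarrow> Max ((\<lambda>a. norm (fermat_sum p a (Np p)) ^ (2 * \<nu>)) ` {a :: int. coprime a (int p)})
        = norm (fermat_sum p (a p) (Np p)) ^ (2 * \<nu>)" by blast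
    \<comment> \<open>The least power of two beyond \<open>2 * N\<close> exceeds every length
      \<open>Np p\<close> and is still at most \<open>4 * N\<close>.\<close>
    obtain l where l: "2 ^ l \<le> 2 * N" "2 * N < 2 ^ (l + 1)"
      using ex_power_ivl1[of 2 "2 * N"] N(1) by auto
    define k where "k = l + 1"
    have k: "2 * N < 2 ^ k" "2 ^ k \<le> 4 * N" using l by (auto simp: k_def)
    have k_real: "(2 ^ k :: real) \<le> 4 * real N" using k(2) by (metis of_nat_le_iff of_nat_mult of_nat_numeral of_nat_power)
    have "(2 ^ k) ^ \<nu> \<le> (4 * P\<^sup>2) ^ \<nu>" using k(2) N(2) by (intro power_mono) auto
    hence D_le: "max_num_divisors ((2 ^ k) ^ \<nu>) \<le> D P"
      unfolding D_def max_num_divisors_def by (intro Max_mono image_mono) auto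
    \<comment> \<open>\<open>2 ^ k\<close> has \<open>k + 1\<close> divisors, so that \<open>D P\<close> also absorbs the logarithmic factors\<close>
    have "(2::nat) ^ k \<le> (2 ^ k) ^ \<nu>" using assms by (intro self_le_power) auto
    hence k_le: "k \<le> D P" using D_le le_max_num_divisors_power_two le_trans by blast
    have "(\<Sum>p\<in>J. Max ((\<lambda>a. norm (fermat_sum p a (Np p)) ^ (2 * \<nu>)) ` {a :: int. coprime a (int p)}))
        = (\<Sum>p\<in>J. norm (\<Sum>n<Np p. chi p (a p) (int n + 1)) ^ (2 * \<nu>))"
      using a(2) by (simp add: fermat_sum_eq_chi)
    also have "\<dots> \<le> real k ^ (2 * \<nu> + 1) * real (max_num_divisors ((2 ^ k) ^ \<nu>)) ^ \<nu>
        * (8 * (2 ^ k) ^ \<nu> + 8 * real P ^ 3) * (2 ^ k) ^ \<nu>"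
    proof (rule moment_chi_prefix_le[OF _ assms])
      show "Np p < 2 ^ k" if "p \<in> J" for p
      proof -
        have "Np p \<le> 2 * N" using Np that by (simp add: J_def)
        thus ?thesis using k(1) by simp
      qed
    qed (use P a(1) in \<open>auto simp: J_def\<close>)
    also have "\<dots> \<le> real (D P) ^ (2 * \<nu> + 1) * real (D P) ^ \<nu>
        * (8 * (4 * real N) ^ \<nu> + 8 * real P ^ 3) * (4 * real N) ^ \<nu>"
      using k_le D_le k_real by (intro mult_mono power_mono add_mono) auto
    also have "\<dots> = real (D P) ^ r * (8 * (4 * real N) ^ \<nu> + 8 * real P ^ 3) * (4 * real N) ^ \<nu>"
      by (simp add: r_def flip: power_add)
    \<comment> \<open>The extra \<open>4 ^ \<nu>\<close> at the cube of \<open>P\<close> gives both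
      terms the common factor needed to extract \<open>K\<close>.\<close>
    also have "\<dots> \<le> real (D P) ^ r * (8 * (4 * real N) ^ \<nu> + 8 * 4 ^ \<nu> * real P ^ 3) * (4 * real N) ^ \<nu>"
      by (intro mult_right_mono mult_left_mono add_mono) auto
    also have "\<dots> = (real P ^ 3 + real N ^ \<nu>) * real N ^ \<nu> * (K * real (D P) ^ r)"
    proof -
      have "(16 :: real) ^ \<nu> = 4 ^ \<nu> * 4 ^ \<nu>" by (simp flip: power_mult_distrib)
      thus ?thesis by (simp add: K_def power_mult_distrib algebra_simps)
    qed
    also have "K * real (D P) ^ r = real P powr \<epsilon> P"
      unfolding \<epsilon>_def using P KD1[of P] by (subst powr_log_cancel) auto
    also have "(real P ^ 3 + real N ^ \<nu>) * real N ^ \<nu> * real P powr \<epsilon> P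
       \<le> (real P ^ 3 + real N ^ \<nu>
            + min (real N ^ \<nu> * real P powr (1 / 2)) (real N powr (real \<nu> / 2) * real P ^ 2))
          * real N ^ \<nu> * real P powr \<epsilon> P"
    proof (intro mult_right_mono)
      have "0 \<le> min (real N ^ \<nu> * real P powr (1 / 2)) (real N powr (real \<nu> / 2) * real P ^ 2)"
        by (intro min.boundedI mult_nonneg_nonneg) auto
      thus "real P ^ 3 + real N ^ \<nu> \<le> real P ^ 3 + real N ^ \<nu>
          + min (real N ^ \<nu> * real P powr (1 / 2)) (real N powr (real \<nu> / 2) * real P ^ 2)" by linarith
    qed auto
    finally show ?thesis by (simp add: J_def)
  qed
  ultimately show ?thesis
    \<comment> \<open>\<open>P0 = 2\<close> makes the base of the logarithm in
      \<open>\<epsilon>\<close> exceed 1.\<close>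
    by (intro exI[of _ \<epsilon>] conjI exI[of _ 2] exI[of _ 0]) auto
qed

end
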